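(* There is an absolute constant $C>0$ such that the following holds. Let $d\ge 1$, let $B$ be a symmetric convex body in $\mathbb{R}^d$, and let $\Gamma$ be a lattice in $\mathbb{R}^d$. Then there exists a symmetric, infinitely proper GAP $\mathbf{P}$ in $\Gamma$ with $\operatorname{rank}(\mathbf{P})\le d$ such that $$\big((Cd)^{-3d/2}\cdot B\big)\cap\Gamma\subseteq \operatorname{Image}(\mathbf{P})\subseteq B\cap\Gamma\subseteq \operatorname{Image}\big(\mathbf{P}_{(Cd)^{3d/2}}\big),$$ and more generally $$\big((Cd)^{-3d/2}t\cdot B\big)\cap\Gamma\subseteq \operatorname{Image}(\mathbf{P}_t)\subseteq (t\cdot B)\cap\Gamma\qquad\text{for every real } t>0.$$ Furthermore, $$(Cd)^{-7d/2}\,|B\cap\Gamma|\le \operatorname{size}(\mathbf{P})\le |B\cap\Gamma|.$$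
   Context: A convex body in $\mathbb{R}^d$ is a compact convex subset with non-empty interior; it is symmetric if $-B=B$. For a real $\lambda$, $\lambda\cdot B:=\{\lambda x:x\in B\}$. A lattice in $\mathbb{R}^d$ is a discrete additive subgroup of $\mathbb{R}^d$ (not necessarily of full rank). A symmetric generalized arithmetic progression (symmetric GAP) in an abelian group $G$ is a triple $\mathbf{P}=(N,v,r)$, where $r=\operatorname{rank}(\mathbf{P})\ge 0$ is an integer, $N=(N_1,\dots,N_r)$ is a tuple of positive reals (the dimensions) and $v=(v_1,\dots,v_r)$ is a tuple of elements of $G$ (the steps). Its image is $\operatorname{Image}(\mathbf{P}):=\{\sum_{i=1}^r n_iv_i: n_i\in\mathbb{Z},\ |n_i|\le N_i\}\subseteq G$, and its size is $\operatorname{size}(\mathbf{P}):=|\operatorname{Image}(\mathbf{P})|$. For real $t>0$ the dilate is $\mathbf{P}_t:=(tN,v,r)$. $\mathbf{P}$ is proper if the elements $\sum_i n_iv_i$, for integers $n_i$ with $|n_i|\le N_i$, are all distinct; it is $t$-proper if $\mathbf{P}_t$ is proper; and it is infinitely proper if it is $t$-proper for all $t>0$. *)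

theory Defs
  imports "HOL-Analysis.Analysis" "HOL-Library.Function_Algebras"
begin

text \<open>
  The dimension is quantified inside the theorem, after the absolute constant, so it cannot be
  the dimension of a type. Euclidean space of dimension \<open>d\<close> is therefore the library's
  \<^const>\<open>Euclidean_space\<close>: the functions \<open>x :: nat \<Rightarrow> real\<close> with \<open>x i = 0\<close> for all \<open>i \<ge> d\<close>, carrying
  the product topology. The group operations on \<open>nat \<Rightarrow> real\<close> are the pointwise ones of
  \<^theory>\<open>HOL-Library.Function_Algebras\<close>; the pointwise scalar multiplication is added here, which
  makes \<^const>\<open>convex\<close> available.
\<close>

instantiation "fun" :: (type, real_vector) real_vector
begin

definition scaleR_fun :: "real \<Rightarrow> ('a \<Rightarrow> 'b) \<Rightarrow> 'a \<Rightarrow> 'b"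
  where "scaleR_fun c f = (\<lambda>x. c *\<^sub>R f x)"

instance
  by standard (auto simp: scaleR_fun_def fun_eq_iff scaleR_add_right scaleR_add_left)

end

lemma scaleR_fun_apply [simp]: "(c *\<^sub>R f) x = c *\<^sub>R f x"
  by (simp add: scaleR_fun_def)


definition convex_body :: "nat \<Rightarrow> (nat \<Rightarrow> real) set \<Rightarrow> bool"
  where "convex_body d B \<longleftrightarrow>
    compactin (Euclidean_space d) B \<and> convex B \<and> Euclidean_space d interior_of B \<noteq> {}"

definition symmetric_body :: "'a::uminus set \<Rightarrow> bool"
  where "symmetric_body B \<longleftrightarrow> uminus ` B = B"

definition dilate :: "real \<Rightarrow> 'a::real_vector set \<Rightarrow> 'a set"
  where "dilate c B = (\<lambda>x. c *\<^sub>R x) ` B"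

definition additive_subgroup :: "'a::ab_group_add set \<Rightarrow> bool"
  where "additive_subgroup G \<longleftrightarrow>
    0 \<in> G \<and> (\<forall>x\<in>G. \<forall>y\<in>G. x + y \<in> G) \<and> (\<forall>x\<in>G. - x \<in> G)"

text \<open>Lattices are not required to have full rank.\<close>

definition lattice_in :: "nat \<Rightarrow> (nat \<Rightarrow> real) set \<Rightarrow> bool"
  where "lattice_in d \<Gamma> \<longleftrightarrow>
    \<Gamma> \<subseteq> topspace (Euclidean_space d) \<and> additive_subgroup \<Gamma> \<and>
    subtopology (Euclidean_space d) \<Gamma> = discrete_topology \<Gamma>"


text \<open>
  A symmetric GAP of rank \<open>r\<close>. The tuples of dimensions and steps are functions of which only the
  values at \<open>0, \<dots>, r - 1\<close> matter; positivity of the dimensions and membership of the steps in the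
  group are imposed by \<open>gap_in\<close>. The ambient group of the GAP is an additive subgroup of a real
  vector space, so the integer multiple \<open>n v\<close> is written \<open>of_int n *\<^sub>R v\<close>.
\<close>

datatype 'a gap = GAP (gap_rank: nat) (gap_dims: "nat \<Rightarrow> real") (gap_steps: "nat \<Rightarrow> 'a")

definition gap_in :: "'a set \<Rightarrow> 'a gap \<Rightarrow> bool"
  where "gap_in G P \<longleftrightarrow> (\<forall>i<gap_rank P. 0 < gap_dims P i \<and> gap_steps P i \<in> G)"

text \<open>
  Coefficient tuples are extensional functions on \<open>{..<r}\<close>, so that each integer tuple is
  represented exactly once and properness is injectivity.
\<close>

definition gap_coeffs :: "'a gap \<Rightarrow> (nat \<Rightarrow> int) set"
  where "gap_coeffs P = (\<Pi>\<^sub>E i\<in>{..<gap_rank P}. {n. \<bar>real_of_int n\<bar> \<le> gap_dims P i})"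

definition gap_elem :: "'a::real_vector gap \<Rightarrow> (nat \<Rightarrow> int) \<Rightarrow> 'a"
  where "gap_elem P n = (\<Sum>i<gap_rank P. of_int (n i) *\<^sub>R gap_steps P i)"

definition gap_image :: "'a::real_vector gap \<Rightarrow> 'a set"
  where "gap_image P = gap_elem P ` gap_coeffs P"

definition gap_size :: "'a::real_vector gap \<Rightarrow> nat"
  where "gap_size P = card (gap_image P)"

definition gap_dilate :: "real \<Rightarrow> 'a gap \<Rightarrow> 'a gap"
  where "gap_dilate t P = GAP (gap_rank P) (\<lambda>i. t * gap_dims P i) (gap_steps P)"

definition proper :: "'a::real_vector gap \<Rightarrow> bool"
  where "proper P \<longleftrightarrow> inj_on (gap_elem P) (gap_coeffs P)"

definition infinitely_proper :: "'a::real_vector gap \<Rightarrow> bool"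
  where "infinitely_proper P \<longleftrightarrow> (\<forall>t>0. proper (gap_dilate t P))"

end

theory Submission
  imports Defs
begin

text \<open>
  Measure vectors by the gauge \<open>q\<close> of \<open>B\<close>. Choosing successively shortest lattice vectors outside
  the span of the previous ones gives a flag; adapted to it, take a lattice basis \<open>v\<^sub>0, v\<^sub>1, \<dots>\<close> and
  real vectors \<open>e\<^sub>j\<close> congruent to \<open>v\<^sub>j\<close> modulo \<open>span {e\<^sub>k | k < j}\<close> that almost realise the quotient norm
  \<open>c\<^sub>j\<close> of \<open>v\<^sub>j\<close>. A pigeonhole argument in these triangular coordinates replaces Minkowski's second
  theorem: the product of the ratios \<open>l\<^sub>j / c\<^sub>j\<close> of successive minima to quotient norms is at most
  \<open>(8 d)\<^sup>d\<close>. Back substitution then bounds the coefficients of a lattice vector \<open>\<Sum> n\<^sub>j v\<^sub>j\<close> by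
  \<open>\<bar>n\<^sub>j\<bar> q(v\<^sub>j) \<le> K q(\<Sum> n\<^sub>i v\<^sub>i)\<close> with \<open>d K \<le> (384 d)\<^sup>d\<close>, so the progression with steps \<open>v\<^sub>j\<close> and dimensions
  \<open>1 / (d q(v\<^sub>j))\<close> has the required inclusions. Counting lattice points one coordinate at a time gives
  at most \<open>\<Prod> (1 + 2 / c\<^sub>j)\<close> of them in \<open>B\<close>. Since the unit ball is handled through quotient norms only,
  neither John's theorem nor volumes nor determinants are needed.
\<close>

section \<open>Lattices in a seminormed space\<close>

lemma span_image_lessThan:
  "x \<in> span (e ` {..<r::nat}) \<longleftrightarrow> (\<exists>y. x = (\<Sum>j<r. y j *\<^sub>R e j))"
proof (induction r arbitrary: x)
  case 0
  then show ?case by simp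
next
  case (Suc r)
  show ?case
  proof
    assume "x \<in> span (e ` {..<Suc r})"
    then obtain k where "x - k *\<^sub>R e r \<in> span (e ` {..<r})"
      by (auto simp: lessThan_Suc span_breakdown_eq)
    then obtain y where "x - k *\<^sub>R e r = (\<Sum>j<r. y j *\<^sub>R e j)"
      using Suc by blast
    then have "x = (\<Sum>j<Suc r. (y(r := k)) j *\<^sub>R e j)"
      by (simp add: algebra_simps)
    then show "\<exists>y. x = (\<Sum>j<Suc r. y j *\<^sub>R e j)" by blast
  next
    assume "\<exists>y. x = (\<Sum>j<Suc r. y j *\<^sub>R e j)"
    then show "x \<in> span (e ` {..<Suc r})"
      by (auto intro!: span_sum span_scale span_add intro: span_base)
  qed
qed

text \<open>Discreteness of \<open>G\<close> enters as finiteness of balls. It makes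
  \<open>q\<close> positive on nonzero lattice vectors, since all multiples of a lattice vector of
  seminorm 0 would lie in a single ball.\<close>

locale seminormed_lattice =
  fixes q :: "'a::real_vector \<Rightarrow> real" and G :: "'a set"
  assumes q_triangle: "q (x + y) \<le> q x + q y"
    and q_scaleR: "q (t *\<^sub>R x) = \<bar>t\<bar> * q x"
    and subgroup: "additive_subgroup G"
    and finite_ball: "finite {x \<in> G. q x \<le> R}"
begin

lemma q_zero [simp]: "q 0 = 0"
  using q_scaleR[of 0 0] by simp

lemma q_minus [simp]: "q (- x) = q x"
  using q_scaleR[of "-1" x] by simp

lemma q_nonneg [simp]: "0 \<le> q x"
  using q_triangle[of x "- x"] by simp

lemma q_diff: "q (x - y) \<le> q x + q y"
  using q_triangle[of x "- y"] by simp

lemma q_sum: "q (\<Sum>i\<in>I. f i) \<le> (\<Sum>i\<in>I. q (f i))"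
proof (induction I rule: infinite_finite_induct)
  case (insert i I)
  then show ?case using q_triangle[of "f i" "sum f I"] by simp
qed auto

lemma G_zero: "0 \<in> G" and G_add: "x \<in> G \<Longrightarrow> y \<in> G \<Longrightarrow> x + y \<in> G"
  and G_minus: "x \<in> G \<Longrightarrow> - x \<in> G"
  using subgroup by (auto simp: additive_subgroup_def)

lemma G_diff: "x \<in> G \<Longrightarrow> y \<in> G \<Longrightarrow> x - y \<in> G"
  using G_add[of x "- y"] G_minus by simp

lemma G_int_scale: "x \<in> G \<Longrightarrow> of_int n *\<^sub>R x \<in> G"
proof (induction n rule: int_induct[where k = 0])
  case base then show ?case by (simp add: G_zero)
next
  case (step1 i) then show ?case by (simp add: scaleR_add_left G_add)
next
  case (step2 i) then show ?case by (simp add: scaleR_diff_left G_diff)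
qed

lemma G_sum: "(\<And>i. i \<in> I \<Longrightarrow> f i \<in> G) \<Longrightarrow> sum f I \<in> G"
  by (induction I rule: infinite_finite_induct) (auto intro: G_zero G_add)

text \<open>Stands in for \<open>V\<close> being spanned by lattice vectors: rounding inside
  \<open>V\<close> with bounded error is what carries discreteness over to the quotient by
  \<open>V\<close>.\<close>

definition cocompact :: "'a set \<Rightarrow> bool"
  where "cocompact V \<longleftrightarrow> subspace V \<and> (\<exists>S. \<forall>u\<in>V. \<exists>g\<in>G \<inter> V. q (u - g) \<le> S)"

section \<open>Shortest vectors, generators and quotient norms modulo a subspace\<close>

lemma ex_shortest:
  assumes "X \<subseteq> G" "X \<noteq> {}"
  obtains w where "w \<in> X" "\<And>x. x \<in> X \<Longrightarrow> q w \<le> q x"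
proof -
  obtain x0 where x0: "x0 \<in> X" using assms by auto
  define F where "F = {x \<in> X. q x \<le> q x0}"
  have "finite F"
    by (rule finite_subset[OF _ finite_ball[of "q x0"]]) (use assms in \<open>auto simp: F_def\<close>)
  moreover have "F \<noteq> {}" using x0 by (auto simp: F_def)
  ultimately obtain w where w: "w \<in> F" "\<And>x. x \<in> F \<Longrightarrow> q w \<le> q x"
    using arg_min_if_finite(1)[of F q] arg_min_least[of F _ q] by blast
  show ?thesis
  proof (rule that[of w])
    show "w \<in> X" using w by (auto simp: F_def)
    fix x assume "x \<in> X"
    show "q w \<le> q x"
    proof (cases "x \<in> F")
      case False
      then show ?thesis using w(1) \<open>x \<in> X\<close> by (auto simp: F_def)
    qed (use w in auto)
  qed
qed

text \<open>For \<open>w\<close> outside \<open>V\<close>, rounding along \<open>V\<close> moves any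
  lattice vector with \<open>w\<close>-coordinate in (0, 1] into a fixed ball without changing that
  coordinate. Hence there is a least positive coordinate \<tau>, and division with remainder by
  \<tau> shows that it generates all of them. As \<open>w\<close> itself competes, \<tau> \<le>
  1.\<close>

lemma ex_generator:
  assumes V: "cocompact V" and w: "w \<in> G"
  obtains v \<tau> u0 where "v \<in> G" "v = \<tau> *\<^sub>R w + u0" "u0 \<in> V" "0 < \<tau>" "\<tau> \<le> 1"
    "\<And>x t u. x \<in> G \<Longrightarrow> u \<in> V \<Longrightarrow> x = t *\<^sub>R w + u \<Longrightarrow> \<exists>m::int. x - of_int m *\<^sub>R v \<in> V"
proof (cases "w \<in> V")
  case True
  have sV: "subspace V" using V by (auto simp: cocompact_def)
  show ?thesis
  proof (rule that[of w 1 0])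
    fix x t u assume "x \<in> G" "u \<in> V" "x = t *\<^sub>R w + u"
    then have "x - of_int 0 *\<^sub>R w \<in> V"
      using sV True by (simp add: subspace_add subspace_scale)
    then show "\<exists>m::int. x - of_int m *\<^sub>R w \<in> V" by blast
  qed (use w sV in \<open>auto simp: subspace_0\<close>)
next
  case False
  obtain S where sV: "subspace V" and S: "\<And>u. u \<in> V \<Longrightarrow> \<exists>g\<in>G \<inter> V. q (u - g) \<le> S"
    using V by (auto simp: cocompact_def)
  have uniq: "t = t'" if "t *\<^sub>R w + u = t' *\<^sub>R w + u'" "u \<in> V" "u' \<in> V" for t t' u u'
  proof (rule ccontr)
    assume ne: "t \<noteq> t'"
    have "(t - t') *\<^sub>R w = u' - u" using that by (simp add: algebra_simps)
    then have "(1 / (t - t')) *\<^sub>R ((t - t') *\<^sub>R w) \<in> V"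
      using that sV by (simp only: subspace_diff subspace_scale)
    then show False using False ne by simp
  qed
  define F where "F = {x \<in> G. q x \<le> q w + S + q w \<and> (\<exists>t u. 0 < t \<and> t \<le> 1 \<and> u \<in> V \<and> x = t *\<^sub>R w + u)}"
  define T where "T x = (THE t. \<exists>u\<in>V. x = t *\<^sub>R w + u)" for x
  have T: "T (t *\<^sub>R w + u) = t" if "u \<in> V" for t u
    unfolding T_def using uniq that by (intro the_equality) blast+
  have "finite F"
    by (rule finite_subset[OF _ finite_ball[of "q w + S + q w"]]) (auto simp: F_def)
  have "0 \<le> S" using S[OF subspace_0[OF sV]] q_nonneg by (meson order_trans)
  have "\<exists>t u. 0 < t \<and> t \<le> 1 \<and> u \<in> V \<and> w = t *\<^sub>R w + u"
    by (intro exI[of _ 1] exI[of _ 0]) (simp add: subspace_0[OF sV])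
  then have "w \<in> F" using w \<open>0 \<le> S\<close> by (simp add: F_def)
  define v where "v = arg_min_on T F"
  have v: "v \<in> F" "\<And>x. x \<in> F \<Longrightarrow> T v \<le> T x"
    using \<open>finite F\<close> \<open>w \<in> F\<close> arg_min_if_finite(1)[of F T] arg_min_least[of F _ T]
    by (auto simp: v_def)
  then obtain \<tau> u0 where vt: "v \<in> G" "0 < \<tau>" "\<tau> \<le> 1" "u0 \<in> V" "v = \<tau> *\<^sub>R w + u0"
    by (auto simp: F_def)
  then have Tv: "T v = \<tau>" using T by simp
  show ?thesis
  proof (rule that[of v \<tau> u0])
    fix x t u assume x: "x \<in> G" "u \<in> V" "x = t *\<^sub>R w + u"
    define m where "m = \<lfloor>t / \<tau>\<rfloor>"
    define s where "s = t - of_int m * \<tau>"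
    have s: "0 \<le> s" "s < \<tau>"
      using vt floor_divide_lower[of \<tau> t] floor_divide_upper[of \<tau> t]
      by (auto simp: s_def m_def algebra_simps)
    define u1 where "u1 = u - of_int m *\<^sub>R u0"
    have u1: "u1 \<in> V" using x vt sV by (auto simp: u1_def intro!: subspace_diff subspace_scale)
    have eq: "x - of_int m *\<^sub>R v = s *\<^sub>R w + u1"
      using x vt by (simp add: s_def u1_def algebra_simps)
    \<comment> \<open>A positive remainder would, once the \<open>V\<close>-part is rounded, give an
      element of \<open>F\<close> with a coordinate smaller than \<tau>.\<close>
    have "s = 0"
    proof (rule ccontr)
      assume "s \<noteq> 0"
      obtain g where g: "g \<in> G" "g \<in> V" "q (u1 - g) \<le> S" using S[OF u1] by auto
      define z where "z = s *\<^sub>R w + (u1 - g)"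
      have "z = x - of_int m *\<^sub>R v - g" using eq by (simp add: z_def)
      then have "z \<in> G" using x vt g by (auto intro!: G_diff G_int_scale)
      have "s * q w \<le> 1 * q w" using s vt by (intro mult_right_mono) auto
      then have "q z \<le> q w + S + q w"
        using q_triangle[of "s *\<^sub>R w" "u1 - g"] g(3) q_nonneg[of w]
        unfolding z_def q_scaleR abs_of_nonneg[OF s(1)] by linarith
      then have "z \<in> F"
        unfolding F_def using \<open>z \<in> G\<close> s vt \<open>s \<noteq> 0\<close> u1 g sV
        by (auto simp: z_def intro!: exI[of _ s] exI[of _ "u1 - g"] subspace_diff)
      moreover have "T z = s" unfolding z_def using T u1 g sV by (auto intro!: subspace_diff)
      ultimately show False using v Tv s by fastforce
    qed
    then have "x - of_int m *\<^sub>R v \<in> V" using eq u1 by simp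
    then show "\<exists>m::int. x - of_int m *\<^sub>R v \<in> V" by blast
  qed (use vt in auto)
qed

text \<open>\<open>c\<close> is the infimum of \<open>q\<close> over the coset of \<open>v\<close>
  modulo \<open>V\<close>. Once it is shown to be positive, some representative \<open>e\<close> of
  the coset comes within a factor 2 of it.\<close>

lemma ex_quotient_norm:
  assumes V: "cocompact V" and v: "v \<in> G" "v \<notin> V"
  obtains c e where "0 < c" "e - v \<in> V" "q e \<le> 2 * c" "\<And>u. u \<in> V \<Longrightarrow> c \<le> q (v + u)"
proof -
  obtain S where sV: "subspace V" and S: "\<And>u. u \<in> V \<Longrightarrow> \<exists>g\<in>G \<inter> V. q (u - g) \<le> S"
    using V by (auto simp: cocompact_def)
  define N where "N = Suc (card {x \<in> G. q x \<le> 1 + S})"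
  \<comment> \<open>Otherwise rounding the multiples \<open>k (v + u)\<close>, \<open>k < N\<close>, gives \<open>N\<close> lattice points in a fixed ball.\<close>
  have low: "1 / real N < q (v + u)" if u: "u \<in> V" for u
  proof (rule ccontr)
    assume neg: "\<not> 1 / real N < q (v + u)"
    have "\<exists>g\<in>G \<inter> V. q (real k *\<^sub>R u - g) \<le> S" for k
      using S u sV subspace_scale by blast
    then obtain g where g: "\<And>k. g k \<in> G \<inter> V" "\<And>k. q (real k *\<^sub>R u - g k) \<le> S" by metis
    define h where "h k = real k *\<^sub>R v + g k" for k
    have hG: "h k \<in> G" for k
      using g v G_int_scale[of v "int k"] by (auto simp: h_def intro!: G_add)
    have "q (h k) \<le> 1 + S" if "k < N" for k
    proof -
      have "h k = real k *\<^sub>R (v + u) - (real k *\<^sub>R u - g k)" by (simp add: h_def algebra_simps)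
      then have "q (h k) \<le> real k * q (v + u) + S"
        using q_diff[of "real k *\<^sub>R (v + u)" "real k *\<^sub>R u - g k"] g(2)[of k] by (simp add: q_scaleR)
      moreover have "real k * q (v + u) \<le> real N * (1 / real N)"
        using neg that by (intro mult_mono) auto
      ultimately show ?thesis using that by simp
    qed
    then have "h ` {..<N} \<subseteq> {x \<in> G. q x \<le> 1 + S}" using hG by auto
    moreover have "inj_on h {..<N}"
    proof (rule inj_onI, rule ccontr)
      fix k l assume "h k = h l" "k \<noteq> l"
      then have "(real k - real l) *\<^sub>R v = g l - g k" by (simp add: h_def algebra_simps)
      moreover have "g l - g k \<in> V" using g sV by (auto intro: subspace_diff)
      ultimately have "(1 / (real k - real l)) *\<^sub>R ((real k - real l) *\<^sub>R v) \<in> V"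
        using sV subspace_scale by metis
      then show False using v \<open>k \<noteq> l\<close> by simp
    qed
    ultimately have "N \<le> card {x \<in> G. q x \<le> 1 + S}"
      using card_inj_on_le[OF _ _ finite_ball, of h "{..<N}"] by auto
    then show False by (simp add: N_def)
  qed
  define Q where "Q = (\<lambda>u. q (v + u)) ` V"
  have ne: "Q \<noteq> {}" using sV subspace_0 by (auto simp: Q_def)
  have bdd: "bdd_below Q" by (auto simp: Q_def intro!: bdd_belowI[of _ 0])
  have "1 / real N \<le> Inf Q" using low ne by (intro cInf_greatest) (auto simp: Q_def less_imp_le)
  then have pos: "0 < Inf Q" by (rule less_le_trans[rotated]) (simp add: N_def)
  then have "Inf Q < 2 * Inf Q" by simp
  then obtain z where "z \<in> Q" "z < 2 * Inf Q" using cInf_lessD[OF ne] by blast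
  then obtain u where u: "u \<in> V" "q (v + u) < 2 * Inf Q" unfolding Q_def by blast
  show ?thesis
  proof (rule that[of "Inf Q" "v + u"])
    fix u' assume "u' \<in> V"
    then show "Inf Q \<le> q (v + u')" using bdd by (intro cInf_lower) (auto simp: Q_def)
  qed (use pos u in auto)
qed

subsection \<open>Reduced flags\<close>

text \<open>Rounding from the top coordinate down: subtracting \<lfloor>t\<rfloor> times
  \<open>v r\<close> leaves the fractional part of the coordinate along \<open>e r\<close> and
  otherwise disturbs only lower coordinates, which the induction rounds next.\<close>

lemma ex_rounding:
  fixes r :: nat
  assumes "\<And>j. j < r \<Longrightarrow> v j \<in> G \<and> v j - e j \<in> span (e ` {..<j})"
    and "u \<in> span (e ` {..<r})"
  shows "\<exists>g\<in>G \<inter> span (e ` {..<r}). \<exists>y. u - g = (\<Sum>j<r. y j *\<^sub>R e j) \<and> (\<forall>j<r. 0 \<le> y j \<and> y j < 1)"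
  using assms
proof (induction r arbitrary: u)
  case 0
  then show ?case by (auto simp: G_zero)
next
  case (Suc r)
  have ve: "v r \<in> G" "v r - e r \<in> span (e ` {..<r})" using Suc.prems by auto
  have sub: "span (e ` {..<r}) \<subseteq> span (e ` {..<Suc r})" by (intro span_mono) auto
  have er: "e r \<in> span (e ` {..<Suc r})" by (intro span_base) auto
  obtain t where t: "u - t *\<^sub>R e r \<in> span (e ` {..<r})"
    using Suc.prems(2) by (auto simp: lessThan_Suc span_breakdown_eq)
  define m where "m = \<lfloor>t\<rfloor>"
  have "(u - t *\<^sub>R e r) - of_int m *\<^sub>R (v r - e r) \<in> span (e ` {..<r})"
    by (rule span_diff[OF t span_scale[OF ve(2)]])
  from Suc.IH[OF _ this] Suc.prems(1) obtain g y where g: "g \<in> G" "g \<in> span (e ` {..<r})"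
      "(u - t *\<^sub>R e r) - of_int m *\<^sub>R (v r - e r) - g = (\<Sum>j<r. y j *\<^sub>R e j)"
      "\<forall>j<r. 0 \<le> y j \<and> y j < 1"
    by auto
  show ?case
  proof (intro bexI exI conjI)
    have "u - (g + of_int m *\<^sub>R v r) = (\<Sum>j<r. y j *\<^sub>R e j) + (t - of_int m) *\<^sub>R e r"
      using g(3) by (simp add: algebra_simps)
    then show "u - (g + of_int m *\<^sub>R v r) = (\<Sum>j<Suc r. (y(r := t - of_int m)) j *\<^sub>R e j)"
      by simp
    show "\<forall>j<Suc r. 0 \<le> (y(r := t - of_int m)) j \<and> (y(r := t - of_int m)) j < 1"
      using g(4) unfolding m_def by (auto simp: less_Suc_eq) linarith
    have "v r = (v r - e r) + e r" by simp
    then have "v r \<in> span (e ` {..<Suc r})" using ve sub er by (metis span_add subsetD)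
    then show "g + of_int m *\<^sub>R v r \<in> G \<inter> span (e ` {..<Suc r})"
      using g ve sub by (auto intro!: G_add G_int_scale span_add span_scale)
  qed
qed

lemma cocompact_span:
  fixes r :: nat
  assumes "\<And>j. j < r \<Longrightarrow> v j \<in> G \<and> v j - e j \<in> span (e ` {..<j})"
  shows "cocompact (span (e ` {..<r}))"
  unfolding cocompact_def
proof (intro conjI exI ballI subspace_span)
  fix u assume "u \<in> span (e ` {..<r})"
  from ex_rounding[OF assms this] obtain g y where g: "g \<in> G \<inter> span (e ` {..<r})"
    "u - g = (\<Sum>j<r. y j *\<^sub>R e j)" "\<forall>j<r. 0 \<le> y j \<and> y j < 1" by blast
  have "q (u - g) \<le> (\<Sum>j<r. q (y j *\<^sub>R e j))" unfolding g(2) by (rule q_sum)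
  also have "\<dots> \<le> (\<Sum>j<r. q (e j))"
    using g(3) by (intro sum_mono) (auto simp: q_scaleR intro!: mult_left_le_one_le)
  finally show "\<exists>g\<in>G \<inter> span (e ` {..<r}). q (u - g) \<le> (\<Sum>j<r. q (e j))" using g(1) by blast
qed

text \<open>
  The \<open>c j\<close> are quotient norms up to a factor \<open>2\<close>, so that no infimum has to be attained; \<open>l j\<close> is
  the \<open>j\<close>-th successive minimum, and the bound on \<open>\<mu>\<close> is size reduction.
\<close>

definition reduced_flag ::
    "nat \<Rightarrow> (nat \<Rightarrow> 'a) \<Rightarrow> (nat \<Rightarrow> 'a) \<Rightarrow> (nat \<Rightarrow> nat \<Rightarrow> real) \<Rightarrow> (nat \<Rightarrow> real) \<Rightarrow> (nat \<Rightarrow> real) \<Rightarrow> bool"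
  where "reduced_flag r v e \<mu> c l \<longleftrightarrow> (\<forall>j<r.
    v j \<in> G \<and> v j = e j + (\<Sum>k<j. \<mu> j k *\<^sub>R e k) \<and> (\<forall>k<j. \<bar>\<mu> j k\<bar> \<le> 1) \<and>
    0 < c j \<and> q (e j) \<le> 2 * c j \<and> c j \<le> l j \<and>
    (\<forall>t. \<forall>u\<in>span (e ` {..<j}). \<bar>t\<bar> * c j \<le> q (t *\<^sub>R e j + u)) \<and>
    (\<forall>x\<in>G - span (e ` {..<j}). l j \<le> q x) \<and> (\<forall>k\<le>j. l k \<le> l j))"

definition generated_by :: "nat \<Rightarrow> (nat \<Rightarrow> 'a) \<Rightarrow> (nat \<Rightarrow> 'a) \<Rightarrow> bool"
  where "generated_by r v e \<longleftrightarrow>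
    (\<forall>x\<in>G \<inter> span (e ` {..<r}). \<exists>n::nat \<Rightarrow> int. x = (\<Sum>j<r. of_int (n j) *\<^sub>R v j))"

lemma reduced_flagD:
  assumes "reduced_flag r v e \<mu> c l" "j < r"
  shows "v j \<in> G" "v j = e j + (\<Sum>k<j. \<mu> j k *\<^sub>R e k)" "\<And>k. k < j \<Longrightarrow> \<bar>\<mu> j k\<bar> \<le> 1"
    "0 < c j" "q (e j) \<le> 2 * c j" "c j \<le> l j"
    "\<And>t u. u \<in> span (e ` {..<j}) \<Longrightarrow> \<bar>t\<bar> * c j \<le> q (t *\<^sub>R e j + u)"
    "\<And>x. x \<in> G \<Longrightarrow> x \<notin> span (e ` {..<j}) \<Longrightarrow> l j \<le> q x"
    "\<And>k. k \<le> j \<Longrightarrow> l k \<le> l j"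
    "v j - e j \<in> span (e ` {..<j})"
proof -
  have *: "v j = e j + (\<Sum>k<j. \<mu> j k *\<^sub>R e k)" using assms by (auto simp: reduced_flag_def)
  then show "v j - e j \<in> span (e ` {..<j})"
    by (auto simp: algebra_simps intro!: span_sum span_scale intro: span_base)
  show "v j = e j + (\<Sum>k<j. \<mu> j k *\<^sub>R e k)" by (rule *)
qed (use assms in \<open>auto simp: reduced_flag_def\<close>)

text \<open>A shortest lattice vector \<open>w\<close> outside the span gives the next minimum. The
  direction of \<open>w\<close> is then refined to a generator \<open>v0\<close> modulo the span, an
  almost shortest \<open>er\<close> is chosen in its coset, and \<open>v0\<close> is corrected by a
  lattice vector of the span so that it becomes size-reduced against \<open>er\<close> and the
  earlier \<open>e j\<close>.\<close>

lemma reduced_flag_extend: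
  assumes fl: "reduced_flag r v e \<mu> c l" and gen: "generated_by r v e"
    and not_all: "\<not> G \<subseteq> span (e ` {..<r})"
  shows "\<exists>v e \<mu> c l. reduced_flag (Suc r) v e \<mu> c l \<and> generated_by (Suc r) v e"
proof -
  define V where "V = span (e ` {..<r})"
  have sV: "subspace V" by (simp add: V_def)
  have ve: "\<And>j. j < r \<Longrightarrow> v j \<in> G \<and> v j - e j \<in> span (e ` {..<j})" using reduced_flagD(1,10)[OF fl] by simp
  have coV: "cocompact V" unfolding V_def using ve by (rule cocompact_span)
  have "G - V \<noteq> {}" using not_all by (auto simp: V_def)
  then obtain w where w: "w \<in> G" "w \<notin> V" "\<And>x. x \<in> G - V \<Longrightarrow> q w \<le> q x"
    using ex_shortest[of "G - V"] by (metis DiffD1 DiffD2 Diff_subset)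
  obtain v0 \<tau> u0 where v0: "v0 \<in> G" "v0 = \<tau> *\<^sub>R w + u0" "u0 \<in> V" "0 < \<tau>" "\<tau> \<le> 1"
    and v0_gen: "\<And>x t u. x \<in> G \<Longrightarrow> u \<in> V \<Longrightarrow> x = t *\<^sub>R w + u \<Longrightarrow> \<exists>m::int. x - of_int m *\<^sub>R v0 \<in> V"
    using ex_generator[OF coV w(1)] by metis
  have "v0 \<notin> V"
  proof
    assume "v0 \<in> V"
    then have "(1 / \<tau>) *\<^sub>R (v0 - u0) \<in> V" using v0 sV by (simp only: subspace_diff subspace_scale)
    then show False using v0 w by simp
  qed
  then obtain cr er where c: "0 < cr" "er - v0 \<in> V" "q er \<le> 2 * cr" "\<And>u. u \<in> V \<Longrightarrow> cr \<le> q (v0 + u)"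
    using ex_quotient_norm[OF coV v0(1)] by metis
  \<comment> \<open>Rounding this difference leaves coordinates in [0, 1); they become the new row
    of \<mu>.\<close>
  have "v0 - er \<in> span (e ` {..<r})" using c(2) sV V_def by (metis minus_diff_eq subspace_neg)
  from ex_rounding[OF ve this] obtain g y where g: "g \<in> G" "g \<in> V"
    "v0 - er - g = (\<Sum>j<r. y j *\<^sub>R e j)" "\<forall>j<r. 0 \<le> y j \<and> y j < 1"
    unfolding V_def by blast
  define vr where "vr = v0 - g"
  define v' e' \<mu>' c' l' where defs: "v' = v(r := vr)" "e' = e(r := er)" "\<mu>' = \<mu>(r := y)"
    "c' = c(r := cr)" "l' = l(r := q w)"
  have im: "e' ` {..<j} = e ` {..<j}" if "j \<le> r" for j
    using that by (auto simp: defs)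
  have "reduced_flag (Suc r) v' e' \<mu>' c' l'"
    unfolding reduced_flag_def
  proof (intro allI impI)
    fix j assume "j < Suc r"
    then consider "j < r" | "j = r" by linarith
    then show "v' j \<in> G \<and> v' j = e' j + (\<Sum>k<j. \<mu>' j k *\<^sub>R e' k) \<and> (\<forall>k<j. \<bar>\<mu>' j k\<bar> \<le> 1) \<and>
      0 < c' j \<and> q (e' j) \<le> 2 * c' j \<and> c' j \<le> l' j \<and>
      (\<forall>t. \<forall>u\<in>span (e' ` {..<j}). \<bar>t\<bar> * c' j \<le> q (t *\<^sub>R e' j + u)) \<and>
      (\<forall>x\<in>G - span (e' ` {..<j}). l' j \<le> q x) \<and> (\<forall>k\<le>j. l' k \<le> l' j)"
    proof cases
      case 1
      then have "(\<Sum>k<j. \<mu>' j k *\<^sub>R e' k) = (\<Sum>k<j. \<mu> j k *\<^sub>R e k)"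
        by (intro sum.cong) (auto simp: defs)
      moreover have "v' j = v j" "e' j = e j" "\<mu>' j = \<mu> j" "c' j = c j" "l' j = l j"
        "\<And>k. k \<le> j \<Longrightarrow> l' k = l k"
        using 1 by (auto simp: defs)
      ultimately show ?thesis
        using reduced_flagD(1-9)[OF fl 1] 1 by (auto simp: im)
    next
      case 2
      have "vr \<in> G" using v0 g by (auto simp: vr_def intro: G_diff)
      moreover have "vr = er + (\<Sum>k<r. y k *\<^sub>R e' k)"
        using g(3) by (simp add: vr_def defs algebra_simps)
      moreover have "\<forall>k<r. \<bar>y k\<bar> \<le> 1" using g(4) by force
      \<comment> \<open>\<open>v0 - u0\<close> lies in the coset of \<open>v0\<close> and equals
        \<tau> times \<open>w\<close> with \<tau> \<le> 1.\<close>
      moreover have "cr \<le> q w"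
      proof -
        have "cr \<le> q (v0 + - u0)" using v0 sV by (intro c(4)) (auto intro: subspace_neg)
        also have "\<dots> = \<tau> * q w" using v0 by (simp add: q_scaleR)
        also have "\<dots> \<le> 1 * q w" using v0 by (intro mult_right_mono) auto
        finally show ?thesis by simp
      qed
      moreover have "\<bar>t\<bar> * cr \<le> q (t *\<^sub>R er + u)" if u: "u \<in> V" for t u
      proof (cases "t = 0")
        case False
        have "t *\<^sub>R er + u = t *\<^sub>R (v0 + ((er - v0) + (1 / t) *\<^sub>R u))"
          using False by (simp add: scaleR_add_right)
        moreover have "cr \<le> q (v0 + ((er - v0) + (1 / t) *\<^sub>R u))"
          using u c(2) sV by (intro c(4) subspace_add subspace_scale)
        ultimately show ?thesis by (simp only: q_scaleR mult_left_mono abs_ge_zero)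
      qed simp
      \<comment> \<open>\<open>w\<close> lies outside every earlier span too, so it competes with
        each earlier minimum.\<close>
      moreover have "\<forall>k\<le>r. l' k \<le> q w"
      proof (intro allI impI)
        fix k assume "k \<le> r"
        show "l' k \<le> q w"
        proof (cases "k = r")
          case False
          then have "k < r" using \<open>k \<le> r\<close> by simp
          then have "span (e ` {..<k}) \<subseteq> V" unfolding V_def by (intro span_mono) auto
          then have "l k \<le> q w" using reduced_flagD(8)[OF fl \<open>k < r\<close>] w by blast
          then show ?thesis using False by (simp add: defs)
        qed (simp add: defs)
      qed
      ultimately show ?thesis
        unfolding 2 im[OF order_refl] V_def[symmetric] using c w
        by (simp add: defs)
    qed
  qed
  moreover have "generated_by (Suc r) v' e'"
    unfolding generated_by_def
  proof (intro ballI)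
    fix x assume x: "x \<in> G \<inter> span (e' ` {..<Suc r})"
    have "e' ` {..<Suc r} = insert er (e ` {..<r})"
      using im[of r] by (simp add: lessThan_Suc) (simp add: defs)
    then obtain k where k: "x - k *\<^sub>R er \<in> V" using x by (auto simp: span_breakdown_eq V_def)
    \<comment> \<open>Modulo \<open>V\<close>, \<open>er\<close> agrees with \<open>v0\<close>, and
      \<open>v0\<close> with \<tau> times \<open>w\<close>.\<close>
    have "x = (k * \<tau>) *\<^sub>R w + ((x - k *\<^sub>R er) + k *\<^sub>R ((er - v0) + u0))"
      using v0(2) by (simp add: algebra_simps)
    moreover have "(x - k *\<^sub>R er) + k *\<^sub>R ((er - v0) + u0) \<in> V"
      using k c(2) v0(3) sV by (intro subspace_add subspace_scale)
    ultimately obtain m :: int where m: "x - of_int m *\<^sub>R v0 \<in> V" using v0_gen x by blast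
    have "x - of_int m *\<^sub>R vr = (x - of_int m *\<^sub>R v0) + of_int m *\<^sub>R g"
      by (simp add: vr_def algebra_simps)
    then have "x - of_int m *\<^sub>R vr \<in> V" using m g sV by (simp only: subspace_add subspace_scale)
    moreover have "x - of_int m *\<^sub>R vr \<in> G"
      using x v0 g by (auto simp: vr_def intro!: G_diff G_int_scale)
    ultimately obtain n :: "nat \<Rightarrow> int" where n: "x - of_int m *\<^sub>R vr = (\<Sum>j<r. of_int (n j) *\<^sub>R v j)"
      using gen unfolding generated_by_def V_def by blast
    have "x = (\<Sum>j<Suc r. of_int ((n(r := m)) j) *\<^sub>R v' j)"
      using n by (simp add: defs algebra_simps)
    then show "\<exists>n::nat \<Rightarrow> int. x = (\<Sum>j<Suc r. of_int (n j) *\<^sub>R v' j)" by blast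
  qed
  ultimately show ?thesis by blast
qed

text \<open>This ends the construction of flags: positive quotient norms make the \<open>e j\<close>
  independent, and triangularity puts them into any span that contains \<open>G\<close>.\<close>

lemma reduced_flag_rank_le:
  assumes fl: "reduced_flag r v e \<mu> c l" and A: "finite A" "G \<subseteq> span A"
  shows "r \<le> card A"
proof -
  have notin: "e j \<notin> span (e ` {..<j})" if "j < r" for j
  proof
    assume "e j \<in> span (e ` {..<j})"
    then have "\<bar>1\<bar> * c j \<le> q (1 *\<^sub>R e j + - e j)"
      by (intro reduced_flagD(7)[OF fl that] span_neg)
    then show False using reduced_flagD(4)[OF fl that] by simp
  qed
  have ind: "independent (e ` {..<i}) \<and> card (e ` {..<i}) = i" if "i \<le> r" for i
    using that
  proof (induction i)
    case 0
    then show ?case by (simp add: independent_empty)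
  next
    case (Suc i)
    have "e i \<notin> span (e ` {..<i})" using notin Suc.prems by simp
    moreover from this have "e i \<notin> e ` {..<i}" by (metis span_base)
    ultimately show ?case using Suc by (simp add: lessThan_Suc independent_insert)
  qed
  have "e j \<in> span A" if "j < r" for j
    using that
  proof (induction j rule: less_induct)
    case (less j)
    have "(\<Sum>k<j. \<mu> j k *\<^sub>R e k) \<in> span A"
      by (rule span_sum) (use less in \<open>auto intro!: span_scale\<close>)
    moreover have "v j \<in> span A" using reduced_flagD(1)[OF fl less.prems] A by auto
    ultimately have "v j - (\<Sum>k<j. \<mu> j k *\<^sub>R e k) \<in> span A" by (simp only: span_diff)
    then show ?case using reduced_flagD(2)[OF fl less.prems] by simp
  qed
  then have "e ` {..<r} \<subseteq> span A" by auto
  then show ?thesis using independent_span_bound[OF A(1), of "e ` {..<r}"] ind[of r] by simp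
qed

text \<open>A flag of maximal length cannot be extended, so its span contains \<open>G\<close> and
  its vectors \<open>v j\<close> generate all of \<open>G\<close>.\<close>

lemma ex_reduced_flag:
  assumes A: "finite A" "G \<subseteq> span A"
  obtains r v e \<mu> c l where "r \<le> card A" "reduced_flag r v e \<mu> c l"
    "\<And>x. x \<in> G \<Longrightarrow> \<exists>n::nat \<Rightarrow> int. x = (\<Sum>j<r. of_int (n j) *\<^sub>R v j)"
proof -
  define P where "P r \<longleftrightarrow> (\<exists>v e \<mu> c l. reduced_flag r v e \<mu> c l \<and> generated_by r v e)" for r
  have "P 0" by (auto simp: P_def reduced_flag_def generated_by_def)
  moreover have bound: "\<And>r. P r \<Longrightarrow> r \<le> card A"
    using reduced_flag_rank_le[OF _ A] by (auto simp: P_def)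
  ultimately obtain r where r: "P r" "\<And>s. P s \<Longrightarrow> s \<le> r"
    using GreatestI_nat[of P 0 "card A"] Greatest_le_nat[of P _ "card A"] by blast
  then obtain v e \<mu> c l where fl: "reduced_flag r v e \<mu> c l" "generated_by r v e"
    by (auto simp: P_def)
  have "\<not> P (Suc r)" using r(2)[of "Suc r"] by auto
  then have "G \<subseteq> span (e ` {..<r})"
    using reduced_flag_extend[OF fl] unfolding P_def by blast
  then show ?thesis
    using fl bound r by (intro that[of r v e \<mu> c l]) (auto simp: generated_by_def)
qed

end

section \<open>Successive minima and counting\<close>

text \<open>A discrete Gronwall inequality: with tail sums \<open>S k\<close>, the hypothesis reads
  \<open>S (k + 1) \<le> A + 2 * S k\<close>.\<close>

lemma sum_tail_le:
  fixes z :: "nat \<Rightarrow> real"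
  assumes "\<And>j. j < r \<Longrightarrow> z j \<le> A + (\<Sum>i\<in>{j<..<r}. z i)" and "k \<le> r"
  shows "(\<Sum>i\<in>{r - k..<r}. z i) \<le> A * (2 ^ k - 1)"
  using assms(2)
proof (induction k)
  case (Suc k)
  define j where "j = r - Suc k"
  have j: "j < r" "{r - Suc k..<r} = insert j {r - k..<r}" "j \<notin> {r - k..<r}" "{j<..<r} = {r - k..<r}"
    using Suc.prems by (auto simp: j_def)
  have "z j \<le> A + (\<Sum>i\<in>{r - k..<r}. z i)" using assms(1)[OF j(1)] j(4) by simp
  moreover have "(\<Sum>i\<in>{r - Suc k..<r}. z i) = z j + (\<Sum>i\<in>{r - k..<r}. z i)"
    using j(3) by (simp add: j(2))
  ultimately show ?case using Suc by (simp add: algebra_simps)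
qed auto

lemma card_int_le_diameter:
  fixes T :: "int set"
  assumes "finite T" "\<And>s t. s \<in> T \<Longrightarrow> t \<in> T \<Longrightarrow> real_of_int \<bar>s - t\<bar> \<le> D" "0 \<le> D"
  shows "real (card T) \<le> 1 + D"
proof (cases "T = {}")
  case False
  have "T \<subseteq> {Min T..Max T}" using assms(1) by auto
  then have "card T \<le> nat (Max T - Min T + 1)" using card_mono[of "{Min T..Max T}" T] by simp
  moreover have "Min T \<le> Max T" using assms(1) False by simp
  moreover have "real_of_int \<bar>Max T - Min T\<bar> \<le> D"
    using assms(1,2) False by (meson Max_in Min_in)
  ultimately show ?thesis by linarith
qed (use assms in auto)

text \<open>Coordinates are fixed from the top down: with those above \<open>i\<close> fixed, the
  \<open>i\<close>-th takes at most \<open>1 + D i\<close> values. In the induction \<open>m\<close>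
  counts the coordinates that are still free.\<close>

lemma card_le_prod_triangular:
  fixes n :: "'b \<Rightarrow> nat \<Rightarrow> int"
  assumes "\<And>x x' i. x \<in> X \<Longrightarrow> x' \<in> X \<Longrightarrow> i < r \<Longrightarrow> \<forall>j. i < j \<and> j < r \<longrightarrow> n x j = n x' j \<Longrightarrow>
      real_of_int \<bar>n x i - n x' i\<bar> \<le> D i"
    and "\<And>x x'. x \<in> X \<Longrightarrow> x' \<in> X \<Longrightarrow> \<forall>j<r. n x j = n x' j \<Longrightarrow> x = x'"
    and "\<And>i. i < r \<Longrightarrow> 0 \<le> D i" and "finite X"
    and "m \<le> r" "\<forall>x\<in>X. \<forall>x'\<in>X. \<forall>j. m \<le> j \<and> j < r \<longrightarrow> n x j = n x' j"
  shows "real (card X) \<le> (\<Prod>i<m. 1 + D i)"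
  using assms
proof (induction m arbitrary: X)
  case 0
  have "x = x'" if "x \<in> X" "x' \<in> X" for x x'
    by (rule 0(2)[OF that]) (use 0(6) that in blast)
  then have "card X \<le> Suc 0" using card_le_Suc0_iff_eq[OF 0(4)] by blast
  then show ?case by simp
next
  case (Suc m)
  define T where "T = (\<lambda>x. n x m) ` X"
  define Y where "Y t = {x \<in> X. n x m = t}" for t
  have "m < r" using Suc.prems(5) by simp
  have T: "real (card T) \<le> 1 + D m"
  proof (rule card_int_le_diameter)
    fix s t assume "s \<in> T" "t \<in> T"
    then obtain x x' where x: "x \<in> X" "x' \<in> X" "s = n x m" "t = n x' m" by (auto simp: T_def)
    have "\<forall>j. m < j \<and> j < r \<longrightarrow> n x j = n x' j"
      using Suc.prems(6) x(1,2) by (meson Suc_leI)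
    then show "real_of_int \<bar>s - t\<bar> \<le> D m"
      unfolding x(3,4) by (rule Suc.prems(1)[OF x(1,2) \<open>m < r\<close>])
  qed (use Suc.prems(3,4) \<open>m < r\<close> in \<open>auto simp: T_def\<close>)
  have Y: "real (card (Y t)) \<le> (\<Prod>i<m. 1 + D i)" for t
  proof (rule Suc.IH)
    show "\<forall>x\<in>Y t. \<forall>x'\<in>Y t. \<forall>j. m \<le> j \<and> j < r \<longrightarrow> n x j = n x' j"
    proof (intro ballI allI impI)
      fix x x' j assume x: "x \<in> Y t" "x' \<in> Y t" and j: "m \<le> j \<and> j < r"
      then consider "j = m" | "Suc m \<le> j" by linarith
      then show "n x j = n x' j"
      proof cases
        case 2
        then show ?thesis using Suc.prems(6) x j unfolding Y_def by blast
      qed (use x in \<open>simp add: Y_def\<close>)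
    qed
    show "real_of_int \<bar>n x i - n x' i\<bar> \<le> D i"
      if "x \<in> Y t" "x' \<in> Y t" "i < r" "\<forall>j. i < j \<and> j < r \<longrightarrow> n x j = n x' j" for x x' i
      by (rule Suc.prems(1)) (use that in \<open>unfold Y_def, blast+\<close>)
    show "x = x'" if "x \<in> Y t" "x' \<in> Y t" "\<forall>j<r. n x j = n x' j" for x x'
      by (rule Suc.prems(2)) (use that in \<open>unfold Y_def, blast+\<close>)
  qed (use Suc.prems(3,4,5) in \<open>auto simp: Y_def\<close>)
  have "X = (\<Union>t\<in>T. Y t)" by (auto simp: T_def Y_def)
  then have "card X \<le> (\<Sum>t\<in>T. card (Y t))"
    using card_UN_le[of T Y] Suc.prems(4) by (simp add: T_def)
  then have "real (card X) \<le> (\<Sum>t\<in>T. real (card (Y t)))" by (metis of_nat_le_iff of_nat_sum)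
  also have "\<dots> \<le> real (card T) * (\<Prod>i<m. 1 + D i)"
    using Y sum_bounded_above[of T "\<lambda>t. real (card (Y t))"] by simp
  also have "\<dots> \<le> (1 + D m) * (\<Prod>i<m. 1 + D i)"
    using T Suc.prems(3,5) by (intro mult_right_mono prod_nonneg) (auto simp: add_nonneg_nonneg)
  finally show ?case by (simp add: mult.commute)
qed

section \<open>Coordinates of lattice vectors with respect to a reduced flag\<close>

context seminormed_lattice
begin

text \<open>The top coordinate satisfies \<open>\<bar>y m\<bar> * c m \<le> q x\<close> by the
  quotient norm, so removing the top term, of seminorm at most \<open>2 * q x\<close>, leaves a
  vector of seminorm at most \<open>3 * q x\<close>. Each layer therefore costs a factor 3.\<close>

lemma coordinate_bound:
  assumes fl: "reduced_flag r v e \<mu> c l" and "m \<le> r" "j < m"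
  shows "\<bar>y j\<bar> * c j \<le> 3 ^ m * q (\<Sum>k<m. y k *\<^sub>R e k)"
  using assms(2,3)
proof (induction m)
  case (Suc m)
  have m: "m < r" using Suc.prems by simp
  define x where "x = (\<Sum>k<Suc m. y k *\<^sub>R e k)"
  define x' where "x' = (\<Sum>k<m. y k *\<^sub>R e k)"
  have x: "x = y m *\<^sub>R e m + x'" by (simp add: x_def x'_def)
  have "x' \<in> span (e ` {..<m})" unfolding x'_def span_image_lessThan by blast
  then have top: "\<bar>y m\<bar> * c m \<le> q x" using reduced_flagD(7)[OF fl m] x by simp
  have "q x' \<le> q x + \<bar>y m\<bar> * q (e m)"
    using q_diff[of x "y m *\<^sub>R e m"] x by (simp add: q_scaleR)
  also have "\<bar>y m\<bar> * q (e m) \<le> \<bar>y m\<bar> * (2 * c m)"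
    using reduced_flagD(5)[OF fl m] by (intro mult_left_mono) auto
  finally have x'3: "q x' \<le> 3 * q x" using top by simp
  have p: "(3::real) ^ Suc m * q x = 3 ^ m * (3 * q x)" by simp
  show ?case
  proof (cases "j = m")
    case True
    have "1 * q x \<le> 3 ^ Suc m * q x" by (intro mult_right_mono one_le_power) auto
    then show ?thesis using top True by (simp add: x_def)
  next
    case False
    then have "\<bar>y j\<bar> * c j \<le> 3 ^ m * q x'" using Suc by (simp add: x'_def)
    also have "\<dots> \<le> 3 ^ m * (3 * q x)" using x'3 by (intro mult_left_mono) auto
    finally show ?thesis unfolding p[symmetric] by (simp add: x_def)
  qed
qed auto

text \<open>If \<open>i\<close> is the last index with a nonzero coordinate, the vector lies outside
  the span of the earlier \<open>e j\<close>, so its seminorm is at least \<open>l i\<close>. If all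
  coordinates were small, the triangle inequality would bound it by fewer than or exactly
  \<open>r\<close> terms, each below \<open>l i / r\<close>.\<close>

lemma ex_large_coordinate:
  assumes fl: "reduced_flag r v e \<mu> c l" and x: "(\<Sum>j<r. y j *\<^sub>R e j) \<in> G"
    and nz: "\<exists>j<r. y j \<noteq> 0"
  shows "\<exists>j<r. l j \<le> 2 * real r * (\<bar>y j\<bar> * c j)"
proof (rule ccontr)
  assume neg: "\<not> ?thesis"
  define i where "i = Max {j. j < r \<and> y j \<noteq> 0}"
  have "i \<in> {j. j < r \<and> y j \<noteq> 0}" unfolding i_def using nz by (intro Max_in) auto
  then have i: "i < r" "y i \<noteq> 0" by auto
  have above: "y j = 0" if "i < j" "j < r" for j
  proof (rule ccontr)
    assume "y j \<noteq> 0"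
    then have "j \<le> i" unfolding i_def using that by (intro Max_ge) auto
    then show False using that by simp
  qed
  define x where "x = (\<Sum>j<r. y j *\<^sub>R e j)"
  have x1: "x = (\<Sum>j<Suc i. y j *\<^sub>R e j)"
    unfolding x_def using i above by (intro sum.mono_neutral_right) auto
  have "x \<notin> span (e ` {..<i})"
  proof
    assume *: "x \<in> span (e ` {..<i})"
    have "(\<Sum>j<i. y j *\<^sub>R e j) \<in> span (e ` {..<i})" unfolding span_image_lessThan by blast
    then have "(\<Sum>j<i. y j *\<^sub>R e j) - x \<in> span (e ` {..<i})" using * by (rule span_diff)
    then have "\<bar>y i\<bar> * c i \<le> q (y i *\<^sub>R e i + ((\<Sum>j<i. y j *\<^sub>R e j) - x))"
      by (rule reduced_flagD(7)[OF fl i(1)])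
    then have "\<bar>y i\<bar> * c i \<le> 0" unfolding x1 by simp
    then show False using i reduced_flagD(4)[OF fl i(1)] by (simp add: mult_le_0_iff)
  qed
  then have "l i \<le> q x" using reduced_flagD(8)[OF fl i(1)] x by (simp add: x_def)
  also have "q x \<le> (\<Sum>j<Suc i. q (y j *\<^sub>R e j))" unfolding x1 by (rule q_sum)
  also have "\<dots> < (\<Sum>j<Suc i. l i / real r)"
  proof (rule sum_strict_mono)
    fix j assume "j \<in> {..<Suc i}"
    then have j: "j < r" "j \<le> i" using i by auto
    have "q (y j *\<^sub>R e j) \<le> \<bar>y j\<bar> * (2 * c j)"
      using reduced_flagD(5)[OF fl j(1)] by (simp add: q_scaleR mult_left_mono)
    also have "\<dots> < l j / real r" using neg j by (auto simp: field_simps not_le)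
    also have "\<dots> \<le> l i / real r" using reduced_flagD(9)[OF fl i(1) j(2)] by (simp add: divide_right_mono)
    finally show "q (y j *\<^sub>R e j) < l i / real r" .
  qed auto
  also have "\<dots> = real (Suc i) * (l i / real r)" by simp
  also have "\<dots> \<le> real r * (l i / real r)"
    using i reduced_flagD(4,6)[OF fl i(1)] by (intro mult_right_mono) auto
  also have "\<dots> = l i" using i by simp
  finally show False by simp
qed

text \<open>
  Each integer point \<open>m\<close> of a box with about \<open>\<Prod> 2 l\<^sub>j / c\<^sub>j\<close> points is rounded to a lattice vector with
  coordinates \<open>Y m j\<close> in \<open>(m j - 1, m j]\<close>. Two of them in the same cell, of side \<open>l\<^sub>j / (2 r c\<^sub>j)\<close> in
  direction \<open>j\<close>, would differ by a lattice vector contradicting \<open>ex_large_coordinate\<close>, so the cells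
  bound the number of points.
\<close>

lemma prod_minima_le:
  assumes fl: "reduced_flag r v e \<mu> c l"
  shows "(\<Prod>j<r. l j / c j) \<le> (8 * real r) ^ r"
proof (cases "r = 0")
  case False
  have pos: "0 < c j" "0 < l j" "c j \<le> l j" if "j < r" for j
    using reduced_flagD(4,6)[OF fl that] by auto
  \<comment> \<open>The factor 2 pays for the floor: since \<open>l j / c j\<close> is at least 1,
    so rounded it still gives \<open>a j \<ge> l j / c j\<close>.\<close>
  define a where "a j = nat \<lfloor>2 * l j / c j\<rfloor>" for j
  define D where "D = (\<Pi>\<^sub>E j\<in>{..<r}. {..<a j})"
  have "\<exists>Y. (\<Sum>j<r. Y j *\<^sub>R e j) \<in> G \<and> (\<forall>j<r. real (m j) - 1 < Y j \<and> Y j \<le> real (m j))"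
    for m :: "nat \<Rightarrow> nat"
  proof -
    have "(\<Sum>j<r. real (m j) *\<^sub>R e j) \<in> span (e ` {..<r})" unfolding span_image_lessThan by fast
    from ex_rounding[OF _ this, of v] obtain g y where
      g: "g \<in> G" "(\<Sum>j<r. real (m j) *\<^sub>R e j) - g = (\<Sum>j<r. y j *\<^sub>R e j)" "\<forall>j<r. 0 \<le> y j \<and> y j < 1"
      using reduced_flagD(1,10)[OF fl] by blast
    have "(\<Sum>j<r. (real (m j) - y j) *\<^sub>R e j) = g"
      using g(2) by (simp add: scaleR_diff_left sum_subtractf algebra_simps)
    then show ?thesis using g by (intro exI[of _ "\<lambda>j. real (m j) - y j"]) auto
  qed
  then obtain Y where Y: "\<And>m. (\<Sum>j<r. Y m j *\<^sub>R e j) \<in> G"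
      "\<And>m j. j < r \<Longrightarrow> real (m j) - 1 < Y m j \<and> Y m j \<le> real (m j)"
    by metis
  define \<phi> where "\<phi> m = (\<lambda>j\<in>{..<r}. \<lfloor>2 * real r * (c j / l j) * Y m j\<rfloor>)" for m
  have inj: "inj_on \<phi> D"
  proof (rule inj_onI, rule ccontr)
    fix m m' assume m: "m \<in> D" "m' \<in> D" "\<phi> m = \<phi> m'" "m \<noteq> m'"
    then obtain i where i: "i < r" "m i \<noteq> m' i"
      unfolding D_def by (metis PiE_ext lessThan_iff)
    \<comment> \<open>The half-open unit intervals ending at distinct integers are disjoint.\<close>
    have "Y m i \<noteq> Y m' i" using Y(2)[OF i(1), of m] Y(2)[OF i(1), of m'] i(2) by auto
    then have nz: "\<exists>j<r. Y m j - Y m' j \<noteq> 0" using i(1) by auto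
    have "(\<Sum>j<r. (Y m j - Y m' j) *\<^sub>R e j) \<in> G"
      using Y(1)[of m] Y(1)[of m'] by (simp add: scaleR_diff_left sum_subtractf G_diff)
    from ex_large_coordinate[OF fl this nz] obtain j
      where j: "j < r" "l j \<le> 2 * real r * (\<bar>Y m j - Y m' j\<bar> * c j)" by blast
    have "\<lfloor>2 * real r * (c j / l j) * Y m j\<rfloor> = \<lfloor>2 * real r * (c j / l j) * Y m' j\<rfloor>"
      using fun_cong[OF m(3), of j] j(1) by (simp only: \<phi>_def restrict_apply lessThan_iff if_True)
    then have "\<bar>2 * real r * (c j / l j) * Y m j - 2 * real r * (c j / l j) * Y m' j\<bar> < 1"
      by linarith
    also have "2 * real r * (c j / l j) * Y m j - 2 * real r * (c j / l j) * Y m' j =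
        (2 * real r * (c j / l j)) * (Y m j - Y m' j)" by (simp only: right_diff_distrib)
    also have "\<bar>\<dots>\<bar> = 2 * real r * (\<bar>Y m j - Y m' j\<bar> * c j) / l j"
      using pos[OF j(1)] by (simp add: abs_mult)
    finally show False using j(2) pos[OF j(1)] by simp
  qed
  \<comment> \<open>\<open>c j / l j * Y m j\<close> lies between -1 and 2; scaling by
    \<open>2 * r\<close> gives this range of \<open>6 * r + 1\<close> cells per coordinate, at most
    \<open>8 * r\<close> of them.\<close>
  define B where "B = (\<Pi>\<^sub>E j\<in>{..<r}. {- 2 * int r..4 * int r})"
  have sub: "\<phi> ` D \<subseteq> B"
  proof
    fix z assume "z \<in> \<phi> ` D"
    then obtain m where m: "m \<in> D" "z = \<phi> m" by auto
    have "\<lfloor>2 * real r * (c j / l j) * Y m j\<rfloor> \<in> {- 2 * int r..4 * int r}" if j: "j < r" for j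
    proof -
      have c: "0 \<le> c j / l j" "c j / l j \<le> 1" using pos[OF j] by auto
      have "m j < a j" using m j by (auto simp: D_def)
      then have "real (m j) \<le> 2 * l j / c j" unfolding a_def by linarith
      then have "c j / l j * Y m j \<le> c j / l j * (2 * l j / c j)"
        using Y(2)[OF j, of m] c by (intro mult_left_mono) linarith+
      also have "\<dots> = 2" using pos[OF j] by simp
      finally have "2 * real r * (c j / l j * Y m j) \<le> 2 * real r * 2" by (intro mult_left_mono) auto
      moreover have "c j / l j * (-1) \<le> c j / l j * Y m j"
        using Y(2)[OF j, of m] c by (intro mult_left_mono) linarith+
      then have "-1 \<le> c j / l j * Y m j" using c by linarith
      then have "2 * real r * (-1) \<le> 2 * real r * (c j / l j * Y m j)" by (intro mult_left_mono) auto
      ultimately show ?thesis by (auto simp: le_floor_iff floor_le_iff mult.assoc)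
    qed
    then show "z \<in> B" using m by (auto simp: \<phi>_def B_def)
  qed
  have "finite B" by (auto simp: B_def intro!: finite_PiE)
  have "card D \<le> card B" using card_inj_on_le[OF inj sub \<open>finite B\<close>] .
  then have "(\<Prod>j<r. a j) \<le> nat (6 * int r + 1) ^ r"
    by (simp add: D_def B_def card_PiE)
  also have "\<dots> \<le> (8 * r) ^ r" using False by (intro power_mono) auto
  finally have "real (\<Prod>j<r. a j) \<le> real ((8 * r) ^ r)" by (simp only: of_nat_le_iff)
  moreover have "(\<Prod>j<r. l j / c j) \<le> (\<Prod>j<r. real (a j))"
  proof (intro prod_mono conjI)
    fix j assume "j \<in> {..<r}"
    then have "1 \<le> l j / c j" using pos[of j] by simp
    then show "0 \<le> l j / c j" "l j / c j \<le> real (a j)" unfolding a_def by linarith+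
  qed
  ultimately show ?thesis by simp
qed auto

text \<open>Size reduction at work: \<open>v j\<close> is a combination of at most \<open>r\<close>
  vectors \<open>e k\<close>, with coefficients of modulus at most 1 and
  \<open>q (e k) \<le> 2 * c k \<le> 2 * l j\<close>.\<close>

lemma norm_basis_le:
  assumes fl: "reduced_flag r v e \<mu> c l" and j: "j < r"
  shows "q (v j) \<le> 2 * real r * l j"
proof -
  have "q (v j) \<le> q (e j) + (\<Sum>k<j. q (\<mu> j k *\<^sub>R e k))"
    using q_triangle[of "e j" "\<Sum>k<j. \<mu> j k *\<^sub>R e k"] q_sum[of "\<lambda>k. \<mu> j k *\<^sub>R e k" "{..<j}"]
      reduced_flagD(2)[OF fl j] by simp
  also have "(\<Sum>k<j. q (\<mu> j k *\<^sub>R e k)) \<le> (\<Sum>k<j. q (e k))"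
    using reduced_flagD(3)[OF fl j] by (intro sum_mono) (auto simp: q_scaleR intro!: mult_left_le_one_le)
  also have "q (e j) + (\<Sum>k<j. q (e k)) = (\<Sum>k<Suc j. q (e k))" by simp
  also have "\<dots> \<le> (\<Sum>k<Suc j. 2 * l j)"
  proof (rule sum_mono)
    fix k assume "k \<in> {..<Suc j}"
    then have k: "k < r" "k \<le> j" using j by auto
    show "q (e k) \<le> 2 * l j"
      using reduced_flagD(5,6)[OF fl k(1)] reduced_flagD(9)[OF fl j k(2)] by linarith
  qed
  also have "\<dots> = 2 * real (Suc j) * l j" by simp
  also have "\<dots> \<le> 2 * real r * l j"
    using j reduced_flagD(4,6)[OF fl j] by (intro mult_right_mono) auto
  finally show ?thesis by simp
qed

text \<open>Three losses multiply to the base 48: a power of 3 for reading off coordinates along the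
  \<open>e k\<close>, a power of \<open>8 * r\<close> for replacing \<open>c k\<close> by
  \<open>l k\<close>, and a power of 2 for solving the triangular system for the \<open>n k\<close>.
  The remaining \<open>2 * r\<close> replaces \<open>l j\<close> by \<open>q (v j)\<close>.\<close>

lemma coefficient_bound:
  fixes n :: "nat \<Rightarrow> real"
  assumes fl: "reduced_flag r v e \<mu> c l" and j: "j < r"
  shows "\<bar>n j\<bar> * q (v j) \<le> 2 * real r * (48 * real r) ^ r * q (\<Sum>i<r. n i *\<^sub>R v i)"
proof -
  define x where "x = (\<Sum>i<r. n i *\<^sub>R v i)"
  have pos: "0 < c i" "0 < l i" "c i \<le> l i" if "i < r" for i
    using reduced_flagD(4,6)[OF fl that] by auto
  \<comment> \<open>The coordinate of \<open>x\<close> along \<open>e k\<close> after expanding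
    every \<open>v i\<close>; exchanging the triangular double sum below confirms it.\<close>
  define y where "y k = n k + (\<Sum>i\<in>{k<..<r}. n i * \<mu> i k)" for k
  have "x = (\<Sum>i<r. n i *\<^sub>R (e i + (\<Sum>k<i. \<mu> i k *\<^sub>R e k)))"
    unfolding x_def using reduced_flagD(2)[OF fl] by (intro sum.cong) auto
  also have "\<dots> = (\<Sum>i<r. n i *\<^sub>R e i) + (\<Sum>i<r. \<Sum>k<i. (n i * \<mu> i k) *\<^sub>R e k)"
    by (simp add: scaleR_add_right sum.distrib scaleR_sum_right)
  also have "(\<Sum>i<r. \<Sum>k<i. (n i * \<mu> i k) *\<^sub>R e k) =
      (\<Sum>i\<in>{..<r}. \<Sum>k\<in>{k. k \<in> {..<r} \<and> k < i}. (n i * \<mu> i k) *\<^sub>R e k)"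
    by (intro sum.cong) auto
  also have "\<dots> = (\<Sum>k<r. \<Sum>i\<in>{i. i \<in> {..<r} \<and> k < i}. (n i * \<mu> i k) *\<^sub>R e k)"
    by (intro sum.swap_restrict) auto
  also have "\<dots> = (\<Sum>k<r. \<Sum>i\<in>{k<..<r}. (n i * \<mu> i k) *\<^sub>R e k)"
    by (intro sum.cong) auto
  finally have xy: "x = (\<Sum>k<r. y k *\<^sub>R e k)"
    by (simp add: y_def scaleR_add_left sum.distrib scaleR_sum_left)
  define A where "A = 3 ^ r * (8 * real r) ^ r * q x"
  have A0: "0 \<le> A" by (simp add: A_def)
  have yA: "\<bar>y k\<bar> * l k \<le> A" if k: "k < r" for k
  proof -
    \<comment> \<open>All ratios are at least 1, so a single one is bounded by their
      product.\<close>
    have "l k / c k = (\<Prod>i\<in>{k}. l i / c i)" by simp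
    also have "\<dots> \<le> (\<Prod>i<r. l i / c i)"
      using k pos by (intro prod_mono2) (auto simp: less_imp_le)
    also have "\<dots> \<le> (8 * real r) ^ r" by (rule prod_minima_le[OF fl])
    finally have "(\<bar>y k\<bar> * c k) * (l k / c k) \<le> (3 ^ r * q x) * (8 * real r) ^ r"
      by (rule mult_mono[OF coordinate_bound[OF fl order_refl k, of y, folded xy]])
        (use pos[OF k] in auto)
    then show ?thesis using pos[OF k] by (simp add: A_def algebra_simps)
  qed
  \<comment> \<open>Back substitution: \<open>n k\<close> is \<open>y k\<close> minus multiples of
    the later \<open>n i\<close> with factors at most 1, and \<open>l k \<le> l i\<close> for those
    \<open>i\<close>.\<close>
  have rec: "\<bar>n k\<bar> * l k \<le> A + (\<Sum>i\<in>{k<..<r}. \<bar>n i\<bar> * l i)" if k: "k < r" for k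
  proof -
    have "\<bar>n k\<bar> = \<bar>y k - (\<Sum>i\<in>{k<..<r}. n i * \<mu> i k)\<bar>" by (simp add: y_def)
    also have "\<dots> \<le> \<bar>y k\<bar> + (\<Sum>i\<in>{k<..<r}. \<bar>n i * \<mu> i k\<bar>)"
      by (intro order_trans[OF abs_triangle_ineq4] add_left_mono sum_abs)
    also have "(\<Sum>i\<in>{k<..<r}. \<bar>n i * \<mu> i k\<bar>) \<le> (\<Sum>i\<in>{k<..<r}. \<bar>n i\<bar>)"
      using reduced_flagD(3)[OF fl] by (intro sum_mono) (auto simp: abs_mult intro!: mult_left_le)
    finally have "\<bar>n k\<bar> * l k \<le> (\<bar>y k\<bar> + (\<Sum>i\<in>{k<..<r}. \<bar>n i\<bar>)) * l k"
      using pos[OF k] by (intro mult_right_mono) auto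
    also have "\<dots> = \<bar>y k\<bar> * l k + (\<Sum>i\<in>{k<..<r}. \<bar>n i\<bar> * l k)"
      by (simp add: distrib_right sum_distrib_right)
    also have "\<dots> \<le> A + (\<Sum>i\<in>{k<..<r}. \<bar>n i\<bar> * l i)"
      using yA[OF k] reduced_flagD(9)[OF fl] by (intro add_mono sum_mono mult_left_mono) auto
    finally show ?thesis .
  qed
  have "\<bar>n j\<bar> * l j \<le> (\<Sum>i\<in>{r - r..<r}. \<bar>n i\<bar> * l i)"
    using j pos by (intro member_le_sum) (auto simp: less_imp_le)
  also have "\<dots> \<le> A * (2 ^ r - 1)" using rec by (intro sum_tail_le) auto
  also have "\<dots> \<le> A * 2 ^ r" using A0 by (intro mult_left_mono) auto
  also have "\<dots> = (3 * (8 * real r) * 2) ^ r * q x"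
    by (simp only: A_def power_mult_distrib ac_simps)
  also have "3 * (8 * real r) * 2 = 48 * real r" by simp
  finally have main: "\<bar>n j\<bar> * l j \<le> (48 * real r) ^ r * q x" .
  have "\<bar>n j\<bar> * q (v j) \<le> \<bar>n j\<bar> * (2 * real r * l j)"
    using norm_basis_le[OF fl j] by (intro mult_left_mono) auto
  also have "\<dots> = 2 * real r * (\<bar>n j\<bar> * l j)" by simp
  also have "\<dots> \<le> 2 * real r * ((48 * real r) ^ r * q x)" using main by (intro mult_left_mono) auto
  finally show ?thesis by (simp add: x_def mult.assoc)
qed

end

lemma card_int_abs_le_real:
  assumes "0 \<le> N"
  shows "finite {n::int. \<bar>real_of_int n\<bar> \<le> N}" "1 \<le> real (card {n::int. \<bar>real_of_int n\<bar> \<le> N})"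
    "N \<le> real (card {n::int. \<bar>real_of_int n\<bar> \<le> N})"
proof -
  have *: "{n::int. \<bar>real_of_int n\<bar> \<le> N} = {- \<lfloor>N\<rfloor>..\<lfloor>N\<rfloor>}"
    by (auto simp: abs_le_iff le_floor_iff) linarith+
  have "0 \<le> \<lfloor>N\<rfloor>" using assms by simp
  then show "finite {n::int. \<bar>real_of_int n\<bar> \<le> N}" "1 \<le> real (card {n::int. \<bar>real_of_int n\<bar> \<le> N})"
    "N \<le> real (card {n::int. \<bar>real_of_int n\<bar> \<le> N})"
    unfolding * by (auto, linarith+)
qed

section \<open>Counting points of the unit ball and building the progression\<close>

context seminormed_lattice
begin

text \<open>Two points of the ball differ by a vector of seminorm at most 2. If their coefficients
  agree above \<open>i\<close>, this difference is a multiple of \<open>e i\<close> modulo the lower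
  span, and the quotient norm \<open>c i\<close> bounds that multiple.\<close>

lemma card_ball_le:
  assumes fl: "reduced_flag r v e \<mu> c l"
    and gen: "\<And>x. x \<in> G \<Longrightarrow> \<exists>n::nat \<Rightarrow> int. x = (\<Sum>j<r. of_int (n j) *\<^sub>R v j)"
  shows "real (card {x \<in> G. q x \<le> 1}) \<le> (\<Prod>j<r. 1 + 2 / c j)"
proof -
  obtain n :: "'a \<Rightarrow> nat \<Rightarrow> int" where n: "\<And>x. x \<in> G \<Longrightarrow> x = (\<Sum>j<r. of_int (n x j) *\<^sub>R v j)"
    using gen by metis
  show ?thesis
  proof (rule card_le_prod_triangular[where n = n])
    fix x x' assume "x \<in> {x \<in> G. q x \<le> 1}" "x' \<in> {x \<in> G. q x \<le> 1}" "\<forall>j<r. n x j = n x' j"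
    then show "x = x'" using n[of x] n[of x'] by simp
  next
    fix x x' i
    assume x: "x \<in> {x \<in> G. q x \<le> 1}" "x' \<in> {x \<in> G. q x \<le> 1}" and i: "i < r"
      and above: "\<forall>j. i < j \<and> j < r \<longrightarrow> n x j = n x' j"
    define k where "k j = real_of_int (n x j) - real_of_int (n x' j)" for j
    have "x - x' = (\<Sum>j<r. k j *\<^sub>R v j)"
      using n[of x] n[of x'] x by (simp add: k_def scaleR_diff_left sum_subtractf)
    also have "\<dots> = (\<Sum>j<Suc i. k j *\<^sub>R v j)"
      using i above by (intro sum.mono_neutral_right) (auto simp: k_def)
    also have "\<dots> = k i *\<^sub>R e i + (k i *\<^sub>R (v i - e i) + (\<Sum>j<i. k j *\<^sub>R v j))"
      by (simp add: algebra_simps)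
    finally have eq: "x - x' = k i *\<^sub>R e i + (k i *\<^sub>R (v i - e i) + (\<Sum>j<i. k j *\<^sub>R v j))" .
    have "v j \<in> span (e ` {..<i})" if "j < i" for j
    proof -
      have "v j - e j \<in> span (e ` {..<j})" using reduced_flagD(10)[OF fl] that i by simp
      moreover have "e ` {..<j} \<subseteq> e ` {..<i}" using that by (intro image_mono) auto
      ultimately have "v j - e j \<in> span (e ` {..<i})" using span_mono by blast
      moreover have "e j \<in> span (e ` {..<i})" using that by (intro span_base) auto
      ultimately have "(v j - e j) + e j \<in> span (e ` {..<i})" by (rule span_add)
      then show ?thesis by simp
    qed
    then have "(\<Sum>j<i. k j *\<^sub>R v j) \<in> span (e ` {..<i})"
      by (intro span_sum) (auto intro: span_scale)
    then have "k i *\<^sub>R (v i - e i) + (\<Sum>j<i. k j *\<^sub>R v j) \<in> span (e ` {..<i})"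
      by (rule span_add[OF span_scale[OF reduced_flagD(10)[OF fl i]]])
    then have "\<bar>k i\<bar> * c i \<le> q (x - x')"
      unfolding eq by (rule reduced_flagD(7)[OF fl i])
    also have "\<dots> \<le> 2" using q_diff[of x x'] x by simp
    finally show "real_of_int \<bar>n x i - n x' i\<bar> \<le> 2 / c i"
      using reduced_flagD(4)[OF fl i] by (simp add: k_def field_simps)
  qed (use reduced_flagD(4)[OF fl] finite_ball in \<open>auto simp: less_imp_le\<close>)
qed

lemma ex_comparable_gap:
  assumes A: "finite A" "G \<subseteq> span A" "card A \<le> d" and d: "1 \<le> d"
  obtains P where "gap_in G P" "infinitely_proper P" "gap_rank P \<le> d"
    "\<And>t x. 0 < t \<Longrightarrow> x \<in> G \<Longrightarrow> (384 * real d) ^ d * q x \<le> t \<Longrightarrow> x \<in> gap_image (gap_dilate t P)"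
    "\<And>t x. 0 < t \<Longrightarrow> x \<in> gap_image (gap_dilate t P) \<Longrightarrow> x \<in> G \<and> q x \<le> t"
    "real (card {x \<in> G. q x \<le> 1}) \<le> (48 * real d ^ 3) ^ d * real (gap_size P)"
proof -
  obtain r v e \<mu> c l where r: "r \<le> card A" and fl: "reduced_flag r v e \<mu> c l"
    and gen: "\<And>x. x \<in> G \<Longrightarrow> \<exists>n::nat \<Rightarrow> int. x = (\<Sum>j<r. of_int (n j) *\<^sub>R v j)"
    using ex_reduced_flag[OF A(1,2)] by metis
  have rd: "r \<le> d" using r A(3) by simp
  have pos: "0 < c j" "0 < l j" if "j < r" for j
    using reduced_flagD(4,6)[OF fl that] by auto
  have cv: "c j \<le> q (v j)" if "j < r" for j
    using reduced_flagD(7)[OF fl that reduced_flagD(10)[OF fl that], of 1] by simp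
  have vpos: "0 < q (v j)" if "j < r" for j using cv[OF that] pos[OF that] by simp
  define K where "K = 2 * real r * (48 * real r) ^ r"
  have K: "\<bar>n j\<bar> * q (v j) \<le> K * q (\<Sum>i<r. n i *\<^sub>R v i)" if "j < r" for n j
    unfolding K_def by (rule coefficient_bound[OF fl that])
  \<comment> \<open>The factor \<open>2 * d * d\<close> is absorbed using
    \<open>2 \<le> 2 ^ d\<close> and \<open>d \<le> 2 ^ d\<close>, which multiplies the base 48 by
    8.\<close>
  have Kd: "real d * K \<le> (384 * real d) ^ d"
  proof -
    have "(48 * real r) ^ r \<le> (48 * real d) ^ r" using rd by (intro power_mono) auto
    also have "\<dots> \<le> (48 * real d) ^ d" using rd d by (intro power_increasing) auto
    finally have "K \<le> 2 * real d * (48 * real d) ^ d"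
      unfolding K_def using rd by (intro mult_mono) auto
    then have "real d * K \<le> real d * (2 * real d * (48 * real d) ^ d)" by (intro mult_left_mono) auto
    also have "\<dots> = (2 * (real d * real d)) * (48 * real d) ^ d" by simp
    also have "\<dots> \<le> (2 ^ d * (2 ^ d * 2 ^ d)) * (48 * real d) ^ d"
    proof (intro mult_right_mono mult_mono)
      show "(2::real) \<le> 2 ^ d" using power_increasing[OF d, of "2::real"] by simp
      show "real d \<le> 2 ^ d" by (rule of_nat_less_two_power[THEN less_imp_le])
      show "real d \<le> 2 ^ d" by (rule of_nat_less_two_power[THEN less_imp_le])
    qed auto
    also have "\<dots> = (2 * (2 * 2) * (48 * real d)) ^ d" by (simp only: power_mult_distrib)
    also have "2 * (2 * 2) * (48 * real d) = 384 * real d" by simp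
    finally show ?thesis .
  qed
  \<comment> \<open>With these dimensions each of the at most \<open>d\<close> terms of an element
    of the \<open>t\<close>-dilate has seminorm at most \<open>t / d\<close>.\<close>
  define N where "N j = 1 / (real d * q (v j))" for j
  have N: "0 < N j" if "j < r" for j using vpos[OF that] d by (simp add: N_def)
  define P where "P = GAP r N v"
  have coeffs: "gap_coeffs (gap_dilate t P) = (\<Pi>\<^sub>E i\<in>{..<r}. {n. \<bar>real_of_int n\<bar> \<le> t * N i})" for t
    by (simp add: gap_coeffs_def gap_dilate_def P_def)
  have elem: "gap_elem (gap_dilate t P) n = (\<Sum>j<r. of_int (n j) *\<^sub>R v j)" for t n
    by (simp add: gap_elem_def gap_dilate_def P_def)
  have proper: "proper (gap_dilate t P)" for t
    unfolding proper_def
  proof (rule inj_onI)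
    fix n n' assume n: "n \<in> gap_coeffs (gap_dilate t P)" "n' \<in> gap_coeffs (gap_dilate t P)"
      and "gap_elem (gap_dilate t P) n = gap_elem (gap_dilate t P) n'"
    then have "(\<Sum>j<r. (real_of_int (n j) - real_of_int (n' j)) *\<^sub>R v j) = 0"
      by (simp add: elem scaleR_diff_left sum_subtractf)
    \<comment> \<open>The coefficient bound applied to the zero vector makes the \<open>v j\<close>
      independent, so properness holds whatever the dilation factor.\<close>
    then have "\<bar>real_of_int (n j) - real_of_int (n' j)\<bar> * q (v j) \<le> 0" if "j < r" for j
      using K[OF that, of "\<lambda>j. real_of_int (n j) - real_of_int (n' j)"] by simp
    then have "n j = n' j" if "j < r" for j
      using that vpos[OF that] by (fastforce simp: mult_le_0_iff)
    then show "n = n'" using n unfolding coeffs by (intro PiE_ext) auto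
  qed
  show ?thesis
  proof (rule that[of P])
    show "gap_in G P" using N reduced_flagD(1)[OF fl] by (simp add: gap_in_def P_def)
    show "infinitely_proper P" by (simp add: infinitely_proper_def proper)
    show "gap_rank P \<le> d" using rd by (simp add: P_def)
  next
    fix t x assume t: "0 < t" and x: "x \<in> G" "(384 * real d) ^ d * q x \<le> t"
    obtain n :: "nat \<Rightarrow> int" where n: "x = (\<Sum>j<r. of_int (n j) *\<^sub>R v j)" using gen[OF x(1)] by blast
    have "\<bar>real_of_int (n j)\<bar> \<le> t * N j" if j: "j < r" for j
    proof -
      have "real d * (\<bar>real_of_int (n j)\<bar> * q (v j)) \<le> real d * (K * q x)"
        using K[OF j, of "\<lambda>j. real_of_int (n j)"] n by (intro mult_left_mono) auto
      also have "\<dots> = (real d * K) * q x" by simp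
      also have "\<dots> \<le> (384 * real d) ^ d * q x" using Kd by (intro mult_right_mono) auto
      also have "\<dots> \<le> t" by (rule x(2))
      finally show ?thesis using vpos[OF j] d by (simp add: N_def field_simps)
    qed
    then have "restrict n {..<r} \<in> gap_coeffs (gap_dilate t P)" by (simp add: coeffs)
    moreover have "x = gap_elem (gap_dilate t P) (restrict n {..<r})" by (simp add: elem n)
    ultimately show "x \<in> gap_image (gap_dilate t P)" unfolding gap_image_def by blast
  next
    fix t x assume t: "0 < t" and "x \<in> gap_image (gap_dilate t P)"
    then obtain n where n: "\<And>j. j < r \<Longrightarrow> \<bar>real_of_int (n j)\<bar> \<le> t * N j"
      and x: "x = (\<Sum>j<r. of_int (n j) *\<^sub>R v j)"
      unfolding gap_image_def coeffs by (auto simp: elem PiE_iff)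
    have "x \<in> G" unfolding x using reduced_flagD(1)[OF fl] by (intro G_sum G_int_scale) auto
    have "q x \<le> (\<Sum>j<r. q (of_int (n j) *\<^sub>R v j))" unfolding x by (rule q_sum)
    also have "\<dots> \<le> (\<Sum>j<r. t / real d)"
    proof (rule sum_mono)
      fix j assume "j \<in> {..<r}"
      then have j: "j < r" by simp
      show "q (of_int (n j) *\<^sub>R v j) \<le> t / real d"
        using mult_right_mono[OF n[OF j] q_nonneg[of "v j"]] vpos[OF j] by (simp add: q_scaleR N_def)
    qed
    also have "\<dots> = real r * (t / real d)" by simp
    also have "\<dots> \<le> real d * (t / real d)" using rd t by (intro mult_right_mono) auto
    also have "\<dots> = t" using d by simp
    finally show "x \<in> G \<and> q x \<le> t" using \<open>x \<in> G\<close> by simp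
  next
    define w where "w j = real (card {n::int. \<bar>real_of_int n\<bar> \<le> N j})" for j
    have co1: "gap_coeffs P = (\<Pi>\<^sub>E i\<in>{..<r}. {n. \<bar>real_of_int n\<bar> \<le> N i})"
      by (simp add: gap_coeffs_def P_def)
    have "gap_dilate 1 P = P" by (simp add: gap_dilate_def P_def)
    then have "inj_on (gap_elem P) (gap_coeffs P)" using proper[of 1] by (simp add: proper_def)
    then have "real (gap_size P) = real (card (gap_coeffs P))"
      by (simp add: gap_size_def gap_image_def card_image)
    also have "\<dots> = (\<Prod>j<r. w j)" by (simp add: co1 card_PiE w_def)
    finally have size: "real (gap_size P) = (\<Prod>j<r. w j)" .
    have "real (card {x \<in> G. q x \<le> 1}) \<le> (\<Prod>j<r. 1 + 2 / c j)"
      by (rule card_ball_le[OF fl gen])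
    \<comment> \<open>Factor by factor: \<open>w j\<close> counts the admissible values of the
      \<open>j\<close>-th coefficient, so it is at least 1 and at least \<open>N j\<close>.\<close>
    also have "\<dots> \<le> (\<Prod>j<r. (6 * real d * real d * (l j / c j)) * w j)"
    proof (intro prod_mono conjI)
      fix j assume "j \<in> {..<r}"
      then have j: "j < r" by simp
      show "0 \<le> 1 + 2 / c j" using pos[OF j] by simp
      define b where "b = q (v j)"
      have "2 * real r * l j \<le> 2 * real d * l j"
        using rd pos[OF j] by (intro mult_right_mono) auto
      then have b: "c j \<le> b" "0 < b" "b \<le> 2 * real d * l j"
        using cv[OF j] vpos[OF j] norm_basis_le[OF fl j] unfolding b_def by linarith+
      have w: "1 \<le> w j" "1 / (real d * b) \<le> w j"
        using card_int_abs_le_real[of "N j"] N[OF j] by (auto simp: w_def N_def b_def)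
      have bd: "b \<le> real d * b" using d b by simp
      have "c j + 2 \<le> (3 * real d * b) * w j"
      \<comment> \<open>For a long \<open>v j\<close> the bound \<open>w j \<ge> 1\<close> suffices,
        as \<open>c j + 2 \<le> 3 * d * b\<close>; for a short one \<open>c j + 2 \<le> 3\<close>,
        and \<open>w j \<ge> 1 / (d * b)\<close> cancels the factor \<open>d * b\<close>.\<close>
      proof (cases "real d * b \<ge> 1")
        case True
        have "c j + 2 \<le> 3 * real d * b * 1" using True b bd by linarith
        also have "\<dots> \<le> 3 * real d * b * w j" using w b by (intro mult_left_mono) auto
        finally show ?thesis .
      next
        case False
        have "c j \<le> 1" using False b(1) bd by linarith
        then have "c j + 2 \<le> 3 * real d * b * (1 / (real d * b))" using b d by simp
        also have "\<dots> \<le> 3 * real d * b * w j" using w b by (intro mult_left_mono) auto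
        finally show ?thesis .
      qed
      also have "\<dots> \<le> (3 * real d * (2 * real d * l j)) * w j"
        using w b by (intro mult_right_mono mult_left_mono) auto
      finally have "c j + 2 \<le> 6 * real d * real d * l j * w j" by simp
      then have "(c j + 2) / c j \<le> (6 * real d * real d * l j * w j) / c j"
        using pos[OF j] by (intro divide_right_mono) auto
      then show "1 + 2 / c j \<le> (6 * real d * real d * (l j / c j)) * w j"
        using pos[OF j] by (simp add: add_divide_distrib)
    qed
    also have "\<dots> = (6 * real d * real d) ^ r * (\<Prod>j<r. l j / c j) * real (gap_size P)"
      by (simp only: prod.distrib size prod_constant card_lessThan power_mult_distrib)
    also have "\<dots> \<le> (48 * real d ^ 3) ^ d * real (gap_size P)"
    proof (intro mult_right_mono)
      have "(6 * real d * real d) ^ r * (\<Prod>j<r. l j / c j) \<le> (6 * real d * real d) ^ r * (8 * real r) ^ r"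
        by (intro mult_left_mono prod_minima_le[OF fl]) auto
      also have "\<dots> \<le> (6 * real d * real d) ^ r * (8 * real d) ^ r"
        using rd by (intro mult_left_mono power_mono) auto
      also have "\<dots> = (6 * real d * real d * (8 * real d)) ^ r" by (simp only: power_mult_distrib)
      also have "6 * real d * real d * (8 * real d) = 48 * real d ^ 3" by (simp add: power3_eq_cube)
      also have "(48 * real d ^ 3) ^ r \<le> (48 * real d ^ 3) ^ d"
      proof (intro power_increasing rd)
        have "1 \<le> real d ^ 3" using d by simp
        then show "1 \<le> 48 * real d ^ 3" by linarith
      qed
      finally show "(6 * real d * real d) ^ r * (\<Prod>j<r. l j / c j) \<le> (48 * real d ^ 3) ^ d" .
    qed auto
    finally show "real (card {x \<in> G. q x \<le> 1}) \<le> (48 * real d ^ 3) ^ d * real (gap_size P)" .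
  qed
qed

end

section \<open>Convex bodies and their gauges\<close>

text \<open>As \<open>x\<close> agrees with \<open>p\<close> from coordinate \<open>d\<close> on,
  only finitely many tolerances of a basic product neighbourhood matter, and their minimum is
  positive.\<close>

lemma open_contains_box:
  fixes p :: "nat \<Rightarrow> real"
  assumes "open U" "p \<in> U"
  obtains \<epsilon> where "0 < \<epsilon>" "\<And>x. (\<And>i. i < d \<Longrightarrow> \<bar>x i - p i\<bar> < \<epsilon>) \<Longrightarrow> (\<And>i. d \<le> i \<Longrightarrow> x i = p i) \<Longrightarrow> x \<in> U"
proof -
  have "openin (powertop_real UNIV) U" using assms(1) by (simp add: euclidean_product_topology)
  from product_topology_open_contains_basis[OF this assms(2)]
  obtain V where V: "p \<in> (\<Pi>\<^sub>E i\<in>UNIV. V i)" "\<And>i. openin euclidean (V i)" "(\<Pi>\<^sub>E i\<in>UNIV. V i) \<subseteq> U"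
    by auto
  have "\<exists>\<epsilon>>0. \<forall>s. \<bar>s - p i\<bar> < \<epsilon> \<longrightarrow> s \<in> V i" for i
  proof -
    have "open (V i)" "p i \<in> V i" using V by (auto simp: PiE_iff)
    then show ?thesis by (auto simp: open_dist dist_real_def)
  qed
  then obtain \<delta> where \<delta>: "\<And>i. 0 < \<delta> i" "\<And>i s. \<bar>s - p i\<bar> < \<delta> i \<Longrightarrow> s \<in> V i" by metis
  define \<epsilon> where "\<epsilon> = Min (insert 1 (\<delta> ` {..<d}))"
  show ?thesis
  proof (rule that[of \<epsilon>])
    show "0 < \<epsilon>" using \<delta> by (simp add: \<epsilon>_def)
    fix x assume x: "\<And>i. i < d \<Longrightarrow> \<bar>x i - p i\<bar> < \<epsilon>" "\<And>i. d \<le> i \<Longrightarrow> x i = p i"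
    have "x i \<in> V i" for i
    proof (cases "i < d")
      case True
      then have "\<epsilon> \<le> \<delta> i" unfolding \<epsilon>_def by (intro Min_le) auto
      then show ?thesis using x(1)[OF True] \<delta>(2)[of "x i" i] by linarith
    qed (use x(2) \<delta> in \<open>auto simp: not_less\<close>)
    then show "x \<in> U" using V(3) by (auto simp: PiE_iff)
  qed
qed

lemma convex_bodyE:
  assumes "convex_body d B" "symmetric_body B"
  obtains \<epsilon> R where "0 < \<epsilon>" "\<And>x. \<forall>i\<ge>d. x i = 0 \<Longrightarrow> \<forall>i<d. \<bar>x i\<bar> < \<epsilon> \<Longrightarrow> x \<in> B"
    "\<And>x i. x \<in> B \<Longrightarrow> i < d \<Longrightarrow> \<bar>x i\<bar> \<le> R" "closed B" "convex B" "\<And>x. x \<in> B \<Longrightarrow> - x \<in> B"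
proof -
  have B: "compactin (Euclidean_space d) B" "convex B" "Euclidean_space d interior_of B \<noteq> {}"
    using assms(1) by (auto simp: convex_body_def)
  have neg: "- x \<in> B" if "x \<in> B" for x
    using assms(2) that unfolding symmetric_body_def by blast
  have cp: "compact B" and E: "\<And>x i. x \<in> B \<Longrightarrow> d \<le> i \<Longrightarrow> x i = 0"
    using B(1) by (auto simp: Euclidean_space_def compactin_subtopology euclidean_product_topology)
  have "\<exists>R. \<forall>x\<in>B. \<bar>x i\<bar> \<le> R" for i
  proof -
    have "continuous_on B (\<lambda>x. x i)"
      by (rule continuous_on_product_then_coordinatewise) (rule continuous_on_id)
    then have "bounded ((\<lambda>x. x i) ` B)" using cp compact_continuous_image compact_imp_bounded by blast
    then show ?thesis by (auto simp: bounded_iff)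
  qed
  then obtain R where R: "\<And>i x. x \<in> B \<Longrightarrow> \<bar>x i\<bar> \<le> R i" by metis
  obtain p T where T: "openin (Euclidean_space d) T" "p \<in> T" "T \<subseteq> B"
    using B(3) by (auto simp: interior_of_def)
  then obtain U where U: "open U" "T = U \<inter> {x. \<forall>i\<ge>d. x i = 0}"
    by (auto simp: Euclidean_space_def openin_subtopology euclidean_product_topology)
  have "p \<in> U" "p \<in> B" and pE: "\<And>i. d \<le> i \<Longrightarrow> p i = 0" using T U by auto
  obtain \<epsilon> where \<epsilon>: "0 < \<epsilon>"
    "\<And>x. (\<And>i. i < d \<Longrightarrow> \<bar>x i - p i\<bar> < \<epsilon>) \<Longrightarrow> (\<And>i. d \<le> i \<Longrightarrow> x i = p i) \<Longrightarrow> x \<in> U"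
    using open_contains_box[OF U(1) \<open>p \<in> U\<close>, of d] by metis
  show ?thesis
  proof (rule that[of \<epsilon> "Max (insert 0 (R ` {..<d}))"])
    fix x :: "nat \<Rightarrow> real" assume x: "\<forall>i\<ge>d. x i = 0" "\<forall>i<d. \<bar>x i\<bar> < \<epsilon>"
    have "p + x \<in> U" using x by (intro \<epsilon>(2)) auto
    then have 1: "p + x \<in> B" using T U x pE by auto
    have "p - x \<in> U" using x by (intro \<epsilon>(2)) auto
    then have "p - x \<in> B" using T U x pE by auto
    then have 2: "- (p - x) \<in> B" by (rule neg)
    \<comment> \<open>By symmetry and convexity the box around the interior point \<open>p\<close>
      is recentred at 0: \<open>x\<close> is the midpoint of \<open>p + x\<close> and
      \<open>x - p\<close>.\<close>
    have "(1 / 2) *\<^sub>R (p + x) + (1 / 2) *\<^sub>R (- (p - x)) \<in> B"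
      using 1 2 B(2) by (intro convexD) auto
    moreover have "(1 / 2) *\<^sub>R (p + x) + (1 / 2) *\<^sub>R (- (p - x)) = x"
      by (auto simp: fun_eq_iff algebra_simps)
    ultimately show "x \<in> B" by simp
  next
    fix x i assume "x \<in> B" "i < d"
    then have "R i \<le> Max (insert 0 (R ` {..<d}))" by (intro Max_ge) auto
    then show "\<bar>x i\<bar> \<le> Max (insert 0 (R ` {..<d}))" using R[OF \<open>x \<in> B\<close>, of i] by linarith
  qed (use \<epsilon>(1) cp compact_imp_closed B(2) neg E in auto)
qed

section \<open>The Minkowski functional of an absorbing symmetric convex set\<close>

definition gauge_of :: "'a::real_vector set \<Rightarrow> 'a \<Rightarrow> real"
  where "gauge_of B x = Inf {t. 0 < t \<and> x \<in> dilate t B}"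

lemma mem_dilate_iff: "t \<noteq> 0 \<Longrightarrow> x \<in> dilate t B \<longleftrightarrow> (1 / t) *\<^sub>R x \<in> B"
  by (force simp: dilate_def image_iff)

text \<open>Absorption is asked on a subspace \<open>V\<close> because a body supported on the first
  \<open>d\<close> coordinates absorbs nothing outside them.\<close>

locale absorbing_disc =
  fixes B V :: "'a::real_vector set"
  assumes cvx: "convex B" and sym: "\<And>x. x \<in> B \<Longrightarrow> - x \<in> B" and V: "subspace V"
    and absorbing: "\<And>x. x \<in> V \<Longrightarrow> \<exists>t>0. x \<in> dilate t B"
begin

lemma gauge_le: "0 < t \<Longrightarrow> x \<in> dilate t B \<Longrightarrow> gauge_of B x \<le> t"
  unfolding gauge_of_def by (rule cInf_lower) (auto intro!: bdd_belowI[of _ 0])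

lemma le_gauge:
  assumes "x \<in> V" "\<And>t. 0 < t \<Longrightarrow> x \<in> dilate t B \<Longrightarrow> s \<le> t"
  shows "s \<le> gauge_of B x"
  unfolding gauge_of_def using absorbing[OF assms(1)] assms(2) by (intro cInf_greatest) auto

lemma gauge_nonneg: "x \<in> V \<Longrightarrow> 0 \<le> gauge_of B x"
  by (rule le_gauge) auto

lemma gauge_triangle:
  assumes x: "x \<in> V" and y: "y \<in> V"
  shows "gauge_of B (x + y) \<le> gauge_of B x + gauge_of B y"
proof -
  have "gauge_of B (x + y) \<le> s + t" if s: "0 < s" "x \<in> dilate s B" and t: "0 < t" "y \<in> dilate t B" for s t
  proof (rule gauge_le)
    \<comment> \<open>The vector \<open>x + y\<close> scaled by \<open>1 / (s + t)\<close> is a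
      convex combination of the points of \<open>B\<close> belonging to \<open>x\<close> and
      \<open>y\<close>.\<close>
    have "(s / (s + t)) *\<^sub>R ((1 / s) *\<^sub>R x) + (t / (s + t)) *\<^sub>R ((1 / t) *\<^sub>R y) \<in> B"
      using s t cvx by (intro convexD) (auto simp: mem_dilate_iff add_divide_distrib[symmetric])
    also have "(s / (s + t)) *\<^sub>R ((1 / s) *\<^sub>R x) + (t / (s + t)) *\<^sub>R ((1 / t) *\<^sub>R y) =
        (1 / (s + t)) *\<^sub>R (x + y)"
      using s t by (simp add: scaleR_add_right)
    finally show "x + y \<in> dilate (s + t) B" using s t by (simp add: mem_dilate_iff)
  qed (use s t in simp)
  then have "gauge_of B (x + y) - t \<le> gauge_of B x" if "0 < t" "y \<in> dilate t B" for t
    using that by (intro le_gauge[OF x]) (simp add: le_diff_eq diff_le_eq)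
  then have "gauge_of B (x + y) - gauge_of B x \<le> gauge_of B y"
    by (intro le_gauge[OF y]) (simp add: diff_le_eq add.commute)
  then show ?thesis by simp
qed

lemma gauge_minus: "gauge_of B (- x) = gauge_of B x"
proof -
  have "- x \<in> dilate t B \<longleftrightarrow> x \<in> dilate t B" if "0 < t" for t
    using sym[of "(1 / t) *\<^sub>R x"] sym[of "- ((1 / t) *\<^sub>R x)"] that by (auto simp: mem_dilate_iff)
  then show ?thesis by (simp add: gauge_of_def cong: conj_cong)
qed

lemma gauge_scaleR_le:
  assumes x: "x \<in> V" and t: "0 < t"
  shows "gauge_of B (t *\<^sub>R x) \<le> t * gauge_of B x"
proof -
  have "gauge_of B (t *\<^sub>R x) / t \<le> gauge_of B x"
  proof (rule le_gauge[OF x])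
    fix s :: real assume s: "0 < s" "x \<in> dilate s B"
    then have "t *\<^sub>R x \<in> dilate (t * s) B" using t by (simp add: mem_dilate_iff)
    then show "gauge_of B (t *\<^sub>R x) / t \<le> s"
      using gauge_le[of "t * s"] s t by (simp add: divide_le_eq mult.commute)
  qed
  then show ?thesis using t by (simp add: divide_le_eq mult.commute)
qed

lemma gauge_scaleR_pos:
  assumes x: "x \<in> V" and t: "0 < t"
  shows "gauge_of B (t *\<^sub>R x) = t * gauge_of B x"
proof (rule antisym)
  have "gauge_of B ((1 / t) *\<^sub>R (t *\<^sub>R x)) \<le> (1 / t) * gauge_of B (t *\<^sub>R x)"
    using x t V by (intro gauge_scaleR_le) (auto intro: subspace_scale)
  then show "t * gauge_of B x \<le> gauge_of B (t *\<^sub>R x)" using t by (simp add: le_divide_eq mult.commute)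
qed (rule gauge_scaleR_le[OF assms])

lemma zero_mem: "0 \<in> B"
proof -
  obtain t :: real where "0 < t" "0 \<in> dilate t B" using absorbing[of 0] V subspace_0 by blast
  then show ?thesis by (simp add: mem_dilate_iff)
qed

lemma gauge_zero: "gauge_of B 0 = 0"
proof (rule antisym)
  show "gauge_of B 0 \<le> 0"
    by (rule field_le_epsilon) (use zero_mem in \<open>auto intro!: gauge_le simp: mem_dilate_iff\<close>)
  show "0 \<le> gauge_of B 0" using gauge_nonneg V subspace_0 by blast
qed

lemma gauge_scaleR:
  assumes x: "x \<in> V"
  shows "gauge_of B (t *\<^sub>R x) = \<bar>t\<bar> * gauge_of B x"
proof -
  consider "t = 0" | "0 < t" | "0 < - t" by linarith
  then show ?thesis
  proof cases
    case 3
    then show ?thesis using gauge_scaleR_pos[OF x 3] gauge_minus[of "t *\<^sub>R x"] by simp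
  qed (use gauge_scaleR_pos[OF x] gauge_zero in auto)
qed

text \<open>Some dilate with a smaller factor contains \<open>x\<close>, and shrinking towards 0
  stays in \<open>B\<close>. The strict inequality is essential here, since \<open>B\<close> is not
  assumed closed and the infimum may not be attained.\<close>

lemma dilate_of_gauge_less:
  assumes x: "x \<in> V" and t: "gauge_of B x < t"
  shows "x \<in> dilate t B"
proof -
  have ne: "{t. 0 < t \<and> x \<in> dilate t B} \<noteq> {}" using absorbing[OF x] by auto
  obtain s where s: "0 < s" "x \<in> dilate s B" "s < t"
    using cInf_lessD[OF ne t[unfolded gauge_of_def]] by auto
  have "(s / t) *\<^sub>R ((1 / s) *\<^sub>R x) + (1 - s / t) *\<^sub>R 0 \<in> B"
    using s cvx zero_mem by (intro convexD) (auto simp: mem_dilate_iff)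
  then show ?thesis using s by (simp add: mem_dilate_iff)
qed

end

lemma tendsto_fun_componentwise:
  fixes f :: "'b \<Rightarrow> 'i::countable \<Rightarrow> 'a::metric_space"
  assumes "\<And>i. ((\<lambda>n. f n i) \<longlongrightarrow> l i) F"
  shows "(f \<longlongrightarrow> l) F"
  using assms limitin_componentwise[of "\<lambda>_. euclidean" UNIV f l F]
  by (simp add: euclidean_product_topology)

section \<open>Lattices in Euclidean space\<close>

lemma lattice_in_separated:
  assumes "lattice_in d \<Gamma>"
  obtains \<epsilon> where "0 < \<epsilon>" "\<And>x. x \<in> \<Gamma> \<Longrightarrow> \<forall>i<d. \<bar>x i\<bar> < \<epsilon> \<Longrightarrow> x = 0"
proof -
  have E: "\<And>x i. x \<in> \<Gamma> \<Longrightarrow> d \<le> i \<Longrightarrow> x i = 0" and "0 \<in> \<Gamma>"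
    using assms by (auto simp: lattice_in_def topspace_Euclidean_space additive_subgroup_def)
  then have "openin (subtopology (Euclidean_space d) \<Gamma>) {0}"
    using assms by (simp add: lattice_in_def)
  then obtain U where U: "open U" "{0} = U \<inter> {x. \<forall>i\<ge>d. x i = 0} \<inter> \<Gamma>"
    by (auto simp: Euclidean_space_def openin_subtopology euclidean_product_topology)
  have "0 \<in> U" using U(2) by blast
  obtain \<epsilon> where \<epsilon>: "0 < \<epsilon>"
    "\<And>x. (\<And>i. i < d \<Longrightarrow> \<bar>x i - 0 i\<bar> < \<epsilon>) \<Longrightarrow> (\<And>i. d \<le> i \<Longrightarrow> x i = 0 i) \<Longrightarrow> x \<in> U"
    using open_contains_box[OF U(1) \<open>0 \<in> U\<close>, of d] by metis
  show ?thesis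
  proof (rule that[OF \<epsilon>(1)])
    fix x assume x: "x \<in> \<Gamma>" "\<forall>i<d. \<bar>x i\<bar> < \<epsilon>"
    then have "x \<in> U" using E[OF x(1)] by (intro \<epsilon>(2)) auto
    then show "x = 0" using U(2) E x(1) by blast
  qed
qed

text \<open>Pigeonhole: two lattice points in the same cube of side \<epsilon> differ by a lattice
  vector with all coordinates below \<epsilon>, hence by 0, and the box meets finitely many such
  cubes.\<close>

lemma finite_lattice_box:
  assumes \<Gamma>: "lattice_in d \<Gamma>"
  shows "finite {x \<in> \<Gamma>. \<forall>i<d. \<bar>x i\<bar> \<le> R}" (is "finite ?X")
proof -
  obtain \<epsilon> where \<epsilon>: "0 < \<epsilon>" "\<And>x. x \<in> \<Gamma> \<Longrightarrow> \<forall>i<d. \<bar>x i\<bar> < \<epsilon> \<Longrightarrow> x = 0"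
    using lattice_in_separated[OF \<Gamma>] by metis
  define f where "f x = (\<lambda>i\<in>{..<d}. \<lfloor>x i / \<epsilon>\<rfloor>)" for x :: "nat \<Rightarrow> real"
  have diff: "x - y \<in> \<Gamma>" if "x \<in> \<Gamma>" "y \<in> \<Gamma>" for x y
    using \<Gamma> that unfolding lattice_in_def additive_subgroup_def by (metis diff_conv_add_uminus)
  have "inj_on f ?X"
  proof (rule inj_onI)
    fix x y assume x: "x \<in> ?X" and y: "y \<in> ?X" and eq: "f x = f y"
    have "\<bar>(x - y) i\<bar> < \<epsilon>" if i: "i < d" for i
    proof -
      have "\<lfloor>x i / \<epsilon>\<rfloor> = \<lfloor>y i / \<epsilon>\<rfloor>"
        using fun_cong[OF eq, of i] i by (simp add: f_def)
      then have "\<bar>x i / \<epsilon> - y i / \<epsilon>\<bar> < 1" by linarith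
      then have "\<bar>(x i - y i) / \<epsilon>\<bar> < 1" by (simp add: diff_divide_distrib)
      then show ?thesis using \<epsilon>(1) by simp
    qed
    then have "x - y = 0" using diff x y by (intro \<epsilon>(2)) auto
    then show "x = y" by simp
  qed
  moreover have "f ` ?X \<subseteq> (\<Pi>\<^sub>E i\<in>{..<d}. {\<lfloor>- R / \<epsilon>\<rfloor>..\<lfloor>R / \<epsilon>\<rfloor>})"
  proof clarify
    fix x assume x: "\<forall>i<d. \<bar>x i\<bar> \<le> R"
    have "\<lfloor>x i / \<epsilon>\<rfloor> \<in> {\<lfloor>- R / \<epsilon>\<rfloor>..\<lfloor>R / \<epsilon>\<rfloor>}" if "i < d" for i
    proof -
      have "- R \<le> x i" "x i \<le> R" using x that by (auto simp: abs_le_iff minus_le_iff)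
      then have "- R / \<epsilon> \<le> x i / \<epsilon>" "x i / \<epsilon> \<le> R / \<epsilon>"
        using \<epsilon>(1) by (simp_all only: divide_right_mono less_imp_le)
      then show ?thesis by (simp only: atLeastAtMost_iff floor_mono)
    qed
    then show "f x \<in> (\<Pi>\<^sub>E i\<in>{..<d}. {\<lfloor>- R / \<epsilon>\<rfloor>..\<lfloor>R / \<epsilon>\<rfloor>})"
      by (simp only: f_def restrict_PiE_iff lessThan_iff) simp
  qed
  moreover have "finite (\<Pi>\<^sub>E i\<in>{..<d}. {\<lfloor>- R / \<epsilon>\<rfloor>..\<lfloor>R / \<epsilon>\<rfloor>})" by (intro finite_PiE) auto
  ultimately show ?thesis by (rule inj_on_finite)
qed

lemma sum_fun_apply: "(\<Sum>i\<in>I. f i) x = (\<Sum>i\<in>I. f i x)"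
  by (induction I rule: infinite_finite_induct) auto

lemma ex_spanning_set:
  obtains A :: "(nat \<Rightarrow> real) set" where "finite A" "card A \<le> d" "{x. \<forall>i\<ge>d. x i = 0} \<subseteq> span A"
proof (rule that)
  let ?u = "\<lambda>i j. if j = i then 1 else (0::real)"
  show "finite (?u ` {..<d})" "card (?u ` {..<d}) \<le> d"
    using card_image_le[of "{..<d}" ?u] by auto
  show "{x. \<forall>i\<ge>d. x i = 0} \<subseteq> span (?u ` {..<d})"
  proof
    fix x :: "nat \<Rightarrow> real" assume "x \<in> {x. \<forall>i\<ge>d. x i = 0}"
    then have "x = (\<Sum>i<d. x i *\<^sub>R ?u i)"
      by (auto simp: fun_eq_iff sum_fun_apply if_distrib sum.delta cong: if_cong)
    then show "x \<in> span (?u ` {..<d})" unfolding span_image_lessThan by blast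
  qed
qed

text \<open>Carries the result for seminorms over to \<open>B\<close>: on the space of dimension
  \<open>d\<close>, the dilates of \<open>B\<close> are the closed balls of its gauge.\<close>

lemma ex_comparable_gap_body:
  fixes B \<Gamma> :: "(nat \<Rightarrow> real) set"
  assumes d: "1 \<le> d" and B: "convex_body d B" "symmetric_body B" and \<Gamma>: "lattice_in d \<Gamma>"
  obtains P where "gap_in \<Gamma> P" "infinitely_proper P" "gap_rank P \<le> d"
    "\<And>s t. 0 < s \<Longrightarrow> 0 < t \<Longrightarrow> (384 * real d) ^ d * s \<le> t \<Longrightarrow> dilate s B \<inter> \<Gamma> \<subseteq> gap_image (gap_dilate t P)"
    "\<And>t. 0 < t \<Longrightarrow> gap_image (gap_dilate t P) \<subseteq> dilate t B \<inter> \<Gamma>"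
    "finite (B \<inter> \<Gamma>)"
    "real (card (B \<inter> \<Gamma>)) \<le> (48 * real d ^ 3) ^ d * real (gap_size P)"
proof -
  obtain \<epsilon> R where \<epsilon>: "0 < \<epsilon>" "\<And>x. \<forall>i\<ge>d. x i = 0 \<Longrightarrow> \<forall>i<d. \<bar>x i\<bar> < \<epsilon> \<Longrightarrow> x \<in> B"
    and R: "\<And>x i. x \<in> B \<Longrightarrow> i < d \<Longrightarrow> \<bar>x i\<bar> \<le> R"
    and cl: "closed B" and cv: "convex B" and neg: "\<And>x. x \<in> B \<Longrightarrow> - x \<in> B"
    by (rule convex_bodyE[OF B]) (rule that)
  define V where "V = {x :: nat \<Rightarrow> real. \<forall>i\<ge>d. x i = 0}"
  have sV: "subspace V" by (auto simp: V_def subspace_def)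
  have \<Gamma>V: "\<Gamma> \<subseteq> V" using \<Gamma> by (simp add: lattice_in_def topspace_Euclidean_space V_def)
  interpret absorbing_disc B V
  proof
    fix x assume x: "x \<in> V"
    \<comment> \<open>The added 1 makes \<open>t\<close> positive and every coordinate of the scaled
      vector strictly less than \<epsilon>.\<close>
    define t where "t = ((\<Sum>i<d. \<bar>x i\<bar>) + 1) / \<epsilon>"
    have "0 \<le> (\<Sum>i<d. \<bar>x i\<bar>)" by (intro sum_nonneg) auto
    then have "0 < (\<Sum>i<d. \<bar>x i\<bar>) + 1" by linarith
    then have t: "0 < t" unfolding t_def using \<epsilon>(1) by (rule divide_pos_pos)
    have "\<bar>((1 / t) *\<^sub>R x) i\<bar> < \<epsilon>" if "i < d" for i
    proof -
      have "\<bar>x i\<bar> \<le> (\<Sum>i<d. \<bar>x i\<bar>)" using that by (intro member_le_sum) auto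
      then have "\<bar>x i\<bar> < t * \<epsilon>" using \<epsilon>(1) by (simp add: t_def)
      then show ?thesis using t by (simp add: abs_mult divide_less_eq mult.commute)
    qed
    then have "(1 / t) *\<^sub>R x \<in> B" using x by (intro \<epsilon>(2)) (auto simp: V_def)
    then show "\<exists>t>0. x \<in> dilate t B" using t mem_dilate_iff[of t x B] by auto
  qed (use cv neg sV in auto)
  define pr where "pr x = (\<lambda>i. if i < d then x i else (0::real))" for x
  have prV: "pr x \<in> V" for x by (simp add: pr_def V_def)
  have prid: "pr x = x" if "x \<in> V" for x using that by (auto simp: pr_def V_def fun_eq_iff)
  have pr_add: "pr (x + y) = pr x + pr y" for x y by (auto simp: pr_def fun_eq_iff)
  have pr_scale: "pr (t *\<^sub>R x) = t *\<^sub>R pr x" for t x by (auto simp: pr_def fun_eq_iff)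
  \<comment> \<open>Off \<open>V\<close> the gauge is an infimum over the empty set; the projection makes \<open>q\<close> a seminorm everywhere.\<close>
  define q where "q x = gauge_of B (pr x)" for x
  have mem: "x \<in> dilate t B \<longleftrightarrow> q x \<le> t" if x: "x \<in> V" and t: "0 < t" for x t
  proof
    assume "x \<in> dilate t B"
    then show "q x \<le> t" using gauge_le t prid[OF x] by (simp add: q_def)
  next
    assume q: "q x \<le> t"
    \<comment> \<open>When the gauge equals \<open>t\<close>, slightly larger dilates contain
      \<open>x\<close>; the scaled points converge and \<open>B\<close> is closed.\<close>
    let ?s = "\<lambda>n. t + 1 / real (Suc n)"
    have "(1 / ?s n) *\<^sub>R x \<in> B" for n
    proof -
      have "gauge_of B x < ?s n"
        using q prid[OF x] by (simp add: q_def) (rule le_less_trans, assumption, simp)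
      then show ?thesis using dilate_of_gauge_less[OF x] mem_dilate_iff[of "?s n" x B] t
        by (simp add: add_pos_pos less_imp_neq[symmetric])
    qed
    moreover have "(\<lambda>n. (1 / ?s n) *\<^sub>R x) \<longlonglongrightarrow> (1 / t) *\<^sub>R x"
    proof (rule tendsto_fun_componentwise)
      fix i
      have "(\<lambda>n. (1 / ?s n) * x i) \<longlonglongrightarrow> (1 / (t + 0)) * x i"
        using t by (intro tendsto_intros LIMSEQ_inverse_real_of_nat[unfolded inverse_eq_divide]) auto
      then show "(\<lambda>n. ((1 / ?s n) *\<^sub>R x) i) \<longlonglongrightarrow> ((1 / t) *\<^sub>R x) i" by simp
    qed
    ultimately have "(1 / t) *\<^sub>R x \<in> B"
      using Lim_in_closed_set[OF cl] by (metis (no_types, lifting) eventually_sequentiallyI sequentially_bot)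
    then show "x \<in> dilate t B" using t by (simp add: mem_dilate_iff)
  qed
  have fin: "finite {x \<in> \<Gamma>. q x \<le> s}" for s
  proof (rule finite_subset[OF _ finite_lattice_box[OF \<Gamma>, of "max 1 s * R"]], clarify)
    fix x i assume x: "x \<in> \<Gamma>" "q x \<le> s" and i: "i < d"
    have "x \<in> dilate (max 1 s) B" using mem[of x "max 1 s"] x \<Gamma>V by auto
    then obtain b where b: "b \<in> B" "x = max 1 s *\<^sub>R b" by (auto simp: dilate_def)
    then show "\<bar>x i\<bar> \<le> max 1 s * R" using R[OF b(1) i] by (simp add: abs_mult mult_left_mono)
  qed
  interpret seminormed_lattice q \<Gamma>
  proof
    show "q (x + y) \<le> q x + q y" for x y unfolding q_def pr_add by (rule gauge_triangle[OF prV prV])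
    show "q (t *\<^sub>R x) = \<bar>t\<bar> * q x" for t x unfolding q_def pr_scale by (rule gauge_scaleR[OF prV])
    show "additive_subgroup \<Gamma>" using \<Gamma> by (simp add: lattice_in_def)
  qed (rule fin)
  obtain A :: "(nat \<Rightarrow> real) set" where A: "finite A" "card A \<le> d" "V \<subseteq> span A"
    by (rule ex_spanning_set[of d, folded V_def]) (rule that)
  have GA: "\<Gamma> \<subseteq> span A" using A(3) \<Gamma>V by blast
  obtain P where
    P: "gap_in \<Gamma> P" "infinitely_proper P" "gap_rank P \<le> d"
    and inner: "\<And>t x. 0 < t \<Longrightarrow> x \<in> \<Gamma> \<Longrightarrow> (384 * real d) ^ d * q x \<le> t \<Longrightarrow> x \<in> gap_image (gap_dilate t P)"
    and outer: "\<And>t x. 0 < t \<Longrightarrow> x \<in> gap_image (gap_dilate t P) \<Longrightarrow> x \<in> \<Gamma> \<and> q x \<le> t"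
    and size: "real (card {x \<in> \<Gamma>. q x \<le> 1}) \<le> (48 * real d ^ 3) ^ d * real (gap_size P)"
    by (rule ex_comparable_gap[OF A(1) GA A(2) d]) (rule that)
  have "dilate 1 B = B" by (simp add: dilate_def)
  then have ball: "B \<inter> \<Gamma> = {x \<in> \<Gamma>. q x \<le> 1}" using mem[of _ 1] \<Gamma>V by auto
  show ?thesis
  proof (rule that[OF P])
    fix s t :: real assume st: "0 < s" "0 < t" "(384 * real d) ^ d * s \<le> t"
    show "dilate s B \<inter> \<Gamma> \<subseteq> gap_image (gap_dilate t P)"
    proof clarify
      fix x assume x: "x \<in> dilate s B" "x \<in> \<Gamma>"
      then have "q x \<le> s" using mem[of x s] \<Gamma>V st by auto
      then have "(384 * real d) ^ d * q x \<le> (384 * real d) ^ d * s" by (intro mult_left_mono) auto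
      then show "x \<in> gap_image (gap_dilate t P)"
        using st by (intro inner x) linarith+
    qed
  next
    fix t :: real assume t: "0 < t"
    show "gap_image (gap_dilate t P) \<subseteq> dilate t B \<inter> \<Gamma>" using outer[OF t] mem[OF _ t] \<Gamma>V by blast
  qed (use fin size in \<open>simp_all add: ball\<close>)
qed

theorem theorem1p6:
  shows "\<exists>C::real. C > 0 \<and>
    (\<forall>d::nat. \<forall>B \<Gamma> :: (nat \<Rightarrow> real) set.
      d \<ge> 1 \<longrightarrow> convex_body d B \<longrightarrow> symmetric_body B \<longrightarrow> lattice_in d \<Gamma> \<longrightarrow>
      (\<exists>P :: (nat \<Rightarrow> real) gap.
        gap_in \<Gamma> P \<and> infinitely_proper P \<and> gap_rank P \<le> d \<and>
        dilate ((C * real d) powr (- (3 * real d / 2))) B \<inter> \<Gamma> \<subseteq> gap_image P \<and>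
        gap_image P \<subseteq> B \<inter> \<Gamma> \<and>
        B \<inter> \<Gamma> \<subseteq> gap_image (gap_dilate ((C * real d) powr (3 * real d / 2)) P) \<and>
        (\<forall>t::real. t > 0 \<longrightarrow>
          dilate ((C * real d) powr (- (3 * real d / 2)) * t) B \<inter> \<Gamma>
            \<subseteq> gap_image (gap_dilate t P) \<and>
          gap_image (gap_dilate t P) \<subseteq> dilate t B \<inter> \<Gamma>) \<and>
        (C * real d) powr (- (7 * real d / 2)) * real (card (B \<inter> \<Gamma>)) \<le> real (gap_size P) \<and>
        gap_size P \<le> card (B \<inter> \<Gamma>)))"
proof (intro exI[of _ "384::real"] conjI allI impI)
  fix d :: nat and B \<Gamma> :: "(nat \<Rightarrow> real) set"
  assume d: "d \<ge> 1" and B: "convex_body d B" "symmetric_body B" and \<Gamma>: "lattice_in d \<Gamma>"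
  obtain P where P: "gap_in \<Gamma> P" "infinitely_proper P" "gap_rank P \<le> d"
    and inner: "\<And>s t. 0 < s \<Longrightarrow> 0 < t \<Longrightarrow> (384 * real d) ^ d * s \<le> t \<Longrightarrow> dilate s B \<inter> \<Gamma> \<subseteq> gap_image (gap_dilate t P)"
    and outer: "\<And>t. 0 < t \<Longrightarrow> gap_image (gap_dilate t P) \<subseteq> dilate t B \<inter> \<Gamma>"
    and fin: "finite (B \<inter> \<Gamma>)"
    and size: "real (card (B \<inter> \<Gamma>)) \<le> (48 * real d ^ 3) ^ d * real (gap_size P)"
    by (rule ex_comparable_gap_body[OF d B \<Gamma>]) (rule that)
  \<comment> \<open>Both losses are bounded by powers of \<open>D\<close>: the inclusions cost
    \<open>D ^ d\<close> and the size at most \<open>D ^ (3 * d)\<close>. Since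
    \<open>D \<ge> 1\<close>, the exponents may be raised from \<open>d\<close> to
    \<open>3 * d / 2\<close> and from \<open>3 * d\<close> to \<open>7 * d / 2\<close>.\<close>
  define D where "D = 384 * real d"
  have D: "1 \<le> D" using d by (simp add: D_def)
  define \<alpha> where "\<alpha> = D powr (3 * real d / 2)"
  have \<alpha>: "0 < \<alpha>" "D powr (- (3 * real d / 2)) = 1 / \<alpha>"
    using D by (auto simp: \<alpha>_def powr_minus_divide)
  have "D ^ d = D powr real d" using D by (simp add: powr_realpow)
  also have "\<dots> \<le> \<alpha>" unfolding \<alpha>_def using D by (intro powr_mono) auto
  finally have D\<alpha>: "D ^ d \<le> \<alpha>" .
  have one: "dilate 1 B = B" "gap_dilate 1 P = P"
    by (simp add: dilate_def) (cases P, simp add: gap_dilate_def)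
  have in_t: "dilate (1 / \<alpha> * t) B \<inter> \<Gamma> \<subseteq> gap_image (gap_dilate t P)" if "0 < t" for t
  proof (rule inner)
    show "0 < 1 / \<alpha> * t" using that \<alpha>(1) by simp
    have "D ^ d * (1 / \<alpha> * t) \<le> \<alpha> * (1 / \<alpha> * t)"
      using D\<alpha> that \<alpha>(1) by (intro mult_right_mono) auto
    then show "(384 * real d) ^ d * (1 / \<alpha> * t) \<le> t" using \<alpha>(1) by (simp only: D_def) simp
  qed (rule that)
  have "(48 * real d ^ 3) ^ d \<le> (D ^ 3) ^ d"
    by (intro power_mono) (auto simp: D_def power_mult_distrib)
  also have "\<dots> = D powr real (3 * d)" using D by (simp only: power_mult[symmetric] powr_realpow)
  also have "\<dots> \<le> D powr (7 * real d / 2)" using D by (intro powr_mono) auto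
  finally have "real (card (B \<inter> \<Gamma>)) \<le> D powr (7 * real d / 2) * real (gap_size P)"
    using size by (meson mult_right_mono of_nat_0_le_iff order_trans)
  then have "D powr (- (7 * real d / 2)) * real (card (B \<inter> \<Gamma>)) \<le> real (gap_size P)"
    using D by (simp add: powr_minus_divide divide_le_eq mult.commute)
  moreover have "gap_size P \<le> card (B \<inter> \<Gamma>)"
    unfolding gap_size_def using outer[of 1] fin by (intro card_mono) (auto simp: one)
  moreover have "dilate (1 / \<alpha>) B \<inter> \<Gamma> \<subseteq> gap_image P" using in_t[of 1] by (simp add: one)
  moreover have "gap_image P \<subseteq> B \<inter> \<Gamma>" using outer[of 1] by (simp add: one)
  moreover have "B \<inter> \<Gamma> \<subseteq> gap_image (gap_dilate \<alpha> P)" using inner[of 1 \<alpha>] \<alpha>(1) D\<alpha> by (simp add: one D_def)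
  ultimately show "\<exists>P :: (nat \<Rightarrow> real) gap.
        gap_in \<Gamma> P \<and> infinitely_proper P \<and> gap_rank P \<le> d \<and>
        dilate ((384 * real d) powr (- (3 * real d / 2))) B \<inter> \<Gamma> \<subseteq> gap_image P \<and>
        gap_image P \<subseteq> B \<inter> \<Gamma> \<and>
        B \<inter> \<Gamma> \<subseteq> gap_image (gap_dilate ((384 * real d) powr (3 * real d / 2)) P) \<and>
        (\<forall>t::real. t > 0 \<longrightarrow>
          dilate ((384 * real d) powr (- (3 * real d / 2)) * t) B \<inter> \<Gamma>
            \<subseteq> gap_image (gap_dilate t P) \<and>
          gap_image (gap_dilate t P) \<subseteq> dilate t B \<inter> \<Gamma>) \<and>
        (384 * real d) powr (- (7 * real d / 2)) * real (card (B \<inter> \<Gamma>)) \<le> real (gap_size P) \<and>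
        gap_size P \<le> card (B \<inter> \<Gamma>)"
    unfolding D_def[symmetric] \<alpha>(2) \<alpha>_def[symmetric]
    using P in_t outer by blast
qed simp

end
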